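(* (a) For every $n\ge 1$ and every simplex $T\subset\mathbb{R}^n$ on $n+1$ ordered points: the strength $\sigma(T)$ is invariant under every isometry of $\mathbb{R}^n$, the signed strength $s(T)$ is invariant under every rigid motion of $\mathbb{R}^n$, and both $\sigma(T)$ and $s(T)$ can be computed from the coordinates of the vertices in time $O(n^3)$. The uniform scaling of $\mathbb{R}^n$ by any factor $c>0$ multiplies $\sigma(T)$ and $s(T)$ by $c$. (b) Fix any dimension $n\geq 1$. Then there is a constant $\lambda_n>0$ such that, for any $\varepsilon>0$, if a simplex $Q\subset\mathbb{R}^n$ is obtained from another simplex $T\subset\mathbb{R}^n$ by perturbing every vertex of $T$ within its $\varepsilon$-neighborhood (that is, $T$ has vertices $p_0,\dots,p_n$ and $Q$ has vertices $q_0,\dots,q_n$ with $|p_i-q_i|\le\varepsilon$ for all $i$), then $$|\sigma(T)-\sigma(Q)|\leq 2\lambda_n\varepsilon \quad\text{and}\quad |s(T)-s(Q)|\leq 2\lambda_n\varepsilon,$$ where $\lambda_1=2$, $\lambda_2=\sqrt{3}$, and $\lambda_n\leq \dfrac{2^{n+0.5}}{(n!)\, n^{2n-4}}$ for any $n\geq 3$, e.g. $\lambda_3<0.37$.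
   Context: The (geometric) simplex $T$ on any $n+1$ ordered points $p_0,\dots,p_n\in\mathbb{R}^n$ (not necessarily affinely independent) is the set $\{\sum_{i=0}^n t_ip_i \mid t_i\in[0,1],\ \sum_{i=0}^n t_i=1\}$ together with its ordered vertices $p_0,\dots,p_n$. Its orientation $\mathrm{sign}(T)\in\{-1,0,1\}$ is the sign of the determinant of the $n\times n$ matrix with columns $p_1-p_0,\dots,p_n-p_0$. $\mathrm{vol}(T)$ is the $n$-dimensional volume of $T$, and $|\cdot|$ is the Euclidean norm. The half-perimeter is $p(T)=\frac12\sum_{0\le i<j\le n}|p_i-p_j|$, one half of the sum of all distances between the vertices (each unordered pair counted once). The strength of $T$ is $\sigma(T)=\dfrac{\mathrm{vol}^2(T)}{p^{2n-1}(T)}$, where $\mathrm{vol}^2(T)=(\mathrm{vol}(T))^2$ and $p^{2n-1}(T)=(p(T))^{2n-1}$; if all vertices coincide, so that $p(T)=0$, then $\sigma(T)=0$. The signed strength is $s(T)=\mathrm{sign}(T)\,\sigma(T)$. An isometry is any distance-preserving transformation of $\mathbb{R}^n$ (a composition of a translation and an orthogonal map); a rigid motion is any composition of translations and rotations from $\mathrm{SO}(\mathbb{R}^n)$. A transformation acts on $T$ by acting on its ordered vertices. Time complexity is in the RAM model of computation, where any value in memory can be accessed in constant time and basic real operations (arithmetic, square roots) have unit cost. *)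

theory Defs
  imports "HOL-Analysis.Analysis" "HOL-Library.Landau_Symbols" "Jordan_Normal_Form.Determinant"
begin

text \<open>
  The dimension is quantified inside the theorem (the running time is uniform in it), so points of
  \<open>\<real>\<^sup>n\<close> are elements of \<open>carrier_vec n :: real vec set\<close>. A simplex on \<open>n + 1\<close> ordered points is
  given by its vertex sequence \<open>p 0, \<dots>, p n\<close>; values \<open>p i\<close> with \<open>i > n\<close> are irrelevant.
\<close>

hide_const (open) Determinants.det Finite_Cartesian_Product.vec Finite_Cartesian_Product.transpose

section \<open>Geometry\<close>

definition simplex_points :: "nat \<Rightarrow> (nat \<Rightarrow> real vec) \<Rightarrow> bool" where
  "simplex_points n p \<longleftrightarrow> (\<forall>i\<le>n. p i \<in> carrier_vec n)"

definition vnorm :: "real vec \<Rightarrow> real" where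
  "vnorm v = L2_set (vec_index v) {..<dim_vec v}"

definition simplex_set :: "nat \<Rightarrow> (nat \<Rightarrow> real vec) \<Rightarrow> real vec set" where
  "simplex_set n p =
     {Matrix.vec n (\<lambda>k. \<Sum>i\<le>n. t i * vec_index (p i) k) | t :: nat \<Rightarrow> real.
        (\<forall>i\<le>n. 0 \<le> t i \<and> t i \<le> 1) \<and> (\<Sum>i\<le>n. t i) = 1}"

text \<open>\<open>n\<close>-dimensional Lebesgue measure is the \<open>n\<close>-fold product of \<open>lborel\<close>, which lives on
  extensional functions \<open>{..<n} \<rightarrow>\<^sub>E UNIV\<close>; these are identified with \<open>carrier_vec n\<close>.\<close>

definition volume :: "nat \<Rightarrow> real vec set \<Rightarrow> real" where
  "volume n S = (let L = (\<Pi>\<^sub>M k\<in>{..<n}. (lborel :: real measure))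
                 in measure L (Matrix.vec n -` S \<inter> space L))"

definition simplex_sign :: "nat \<Rightarrow> (nat \<Rightarrow> real vec) \<Rightarrow> real" where
  "simplex_sign n p = sgn (Determinant.det (mat_of_cols n (map (\<lambda>i. p i - p 0) [1..<n+1])))"

definition half_perimeter :: "nat \<Rightarrow> (nat \<Rightarrow> real vec) \<Rightarrow> real" where
  "half_perimeter n p = (1/2) * (\<Sum>j\<le>n. \<Sum>i<j. vnorm (p i - p j))"

definition strength :: "nat \<Rightarrow> (nat \<Rightarrow> real vec) \<Rightarrow> real" where
  "strength n p =
     (if half_perimeter n p = 0 then 0
      else (volume n (simplex_set n p))^2 / half_perimeter n p ^ (2 * n - 1))"

definition signed_strength :: "nat \<Rightarrow> (nat \<Rightarrow> real vec) \<Rightarrow> real" where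
  "signed_strength n p = simplex_sign n p * strength n p"

definition is_isometry :: "nat \<Rightarrow> (real vec \<Rightarrow> real vec) \<Rightarrow> bool" where
  "is_isometry n f \<longleftrightarrow>
     (\<forall>x\<in>carrier_vec n. f x \<in> carrier_vec n) \<and>
     (\<forall>x\<in>carrier_vec n. \<forall>y\<in>carrier_vec n. vnorm (f x - f y) = vnorm (x - y))"

inductive rigid_motion :: "nat \<Rightarrow> (real vec \<Rightarrow> real vec) \<Rightarrow> bool" for n :: nat where
  translation: "b \<in> carrier_vec n \<Longrightarrow> rigid_motion n (\<lambda>x. x + b)"
| rotation: "A \<in> carrier_mat n n \<Longrightarrow> transpose_mat A * A = 1\<^sub>m n \<Longrightarrow> Determinant.det A = 1 \<Longrightarrow>
    rigid_motion n (\<lambda>x. A *\<^sub>v x)"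
| composition: "rigid_motion n f \<Longrightarrow> rigid_motion n g \<Longrightarrow> rigid_motion n (f \<circ> g)"

section \<open>A real random access machine\<close>

text \<open>
  A state consists of index registers holding natural numbers and a random access memory of real
  cells. Every constant, register access, memory access, operation and test costs one unit. There
  is no conversion from real to natural values (no floor), and the only constants are integers.
  Natural subtraction is truncated. Division by zero and roots of negative reals take the values
  of HOL's total functions; a program could detect these cases by one comparison.
\<close>

type_synonym ram_state = "(nat \<Rightarrow> nat) \<times> (nat \<Rightarrow> real)"

datatype iexp =
    INat nat
  | IReg nat
  | IAdd iexp iexp
  | ISub iexp iexp
  | IMul iexp iexp

datatype rexp =
    RConst int
  | RMem iexp
  | RAdd rexp rexp
  | RSub rexp rexp
  | RMul rexp rexp
  | RDiv rexp rexp
  | RSqrt rexp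

datatype bexp =
    BILess iexp iexp
  | BRLess rexp rexp
  | BNot bexp
  | BAnd bexp bexp

datatype prog =
    Skip
  | SetReg nat iexp
  | SetMem iexp rexp
  | Seq prog prog
  | Cond bexp prog prog
  | Loop bexp prog

fun ival :: "iexp \<Rightarrow> ram_state \<Rightarrow> nat" where
  "ival (INat k) s = k"
| "ival (IReg r) s = fst s r"
| "ival (IAdd a b) s = ival a s + ival b s"
| "ival (ISub a b) s = ival a s - ival b s"
| "ival (IMul a b) s = ival a s * ival b s"

fun icost :: "iexp \<Rightarrow> nat" where
  "icost (INat k) = 1"
| "icost (IReg r) = 1"
| "icost (IAdd a b) = 1 + icost a + icost b"
| "icost (ISub a b) = 1 + icost a + icost b"
| "icost (IMul a b) = 1 + icost a + icost b"

fun rval :: "rexp \<Rightarrow> ram_state \<Rightarrow> real" where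
  "rval (RConst k) s = of_int k"
| "rval (RMem a) s = snd s (ival a s)"
| "rval (RAdd x y) s = rval x s + rval y s"
| "rval (RSub x y) s = rval x s - rval y s"
| "rval (RMul x y) s = rval x s * rval y s"
| "rval (RDiv x y) s = rval x s / rval y s"
| "rval (RSqrt x) s = sqrt (rval x s)"

fun rcost :: "rexp \<Rightarrow> nat" where
  "rcost (RConst k) = 1"
| "rcost (RMem a) = 1 + icost a"
| "rcost (RAdd x y) = 1 + rcost x + rcost y"
| "rcost (RSub x y) = 1 + rcost x + rcost y"
| "rcost (RMul x y) = 1 + rcost x + rcost y"
| "rcost (RDiv x y) = 1 + rcost x + rcost y"
| "rcost (RSqrt x) = 1 + rcost x"

fun bval :: "bexp \<Rightarrow> ram_state \<Rightarrow> bool" where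
  "bval (BILess a b) s \<longleftrightarrow> ival a s < ival b s"
| "bval (BRLess x y) s \<longleftrightarrow> rval x s < rval y s"
| "bval (BNot b) s \<longleftrightarrow> \<not> bval b s"
| "bval (BAnd b c) s \<longleftrightarrow> bval b s \<and> bval c s"

fun bcost :: "bexp \<Rightarrow> nat" where
  "bcost (BILess a b) = 1 + icost a + icost b"
| "bcost (BRLess x y) = 1 + rcost x + rcost y"
| "bcost (BNot b) = 1 + bcost b"
| "bcost (BAnd b c) = 1 + bcost b + bcost c"

text \<open>\<open>runs c s t s'\<close>: started in \<open>s\<close>, program \<open>c\<close> halts in state \<open>s'\<close> after \<open>t\<close> time units.\<close>

inductive runs :: "prog \<Rightarrow> ram_state \<Rightarrow> nat \<Rightarrow> ram_state \<Rightarrow> bool" where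
  run_Skip: "runs Skip s 1 s"
| run_SetReg: "runs (SetReg r a) s (1 + icost a) ((fst s)(r := ival a s), snd s)"
| run_SetMem: "runs (SetMem a x) s (1 + icost a + rcost x) (fst s, (snd s)(ival a s := rval x s))"
| run_Seq: "runs c s t s' \<Longrightarrow> runs d s' u s'' \<Longrightarrow> runs (Seq c d) s (t + u) s''"
| run_CondTrue: "bval b s \<Longrightarrow> runs c s t s' \<Longrightarrow> runs (Cond b c d) s (1 + bcost b + t) s'"
| run_CondFalse: "\<not> bval b s \<Longrightarrow> runs d s t s' \<Longrightarrow> runs (Cond b c d) s (1 + bcost b + t) s'"
| run_LoopFalse: "\<not> bval b s \<Longrightarrow> runs (Loop b c) s (1 + bcost b) s"
| run_LoopTrue: "bval b s \<Longrightarrow> runs c s t s' \<Longrightarrow> runs (Loop b c) s' u s'' \<Longrightarrow>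
    runs (Loop b c) s (1 + bcost b + t + u) s''"

text \<open>Register \<open>0\<close> initially holds \<open>n\<close>, and cell \<open>i * n + k\<close> holds coordinate \<open>k < n\<close> of vertex
  \<open>i \<le> n\<close>; everything else is zero. Cells \<open>0\<close> and \<open>1\<close> finally hold the two results.\<close>

definition input_state :: "nat \<Rightarrow> (nat \<Rightarrow> real vec) \<Rightarrow> ram_state" where
  "input_state n p =
     ((\<lambda>_. 0)(0 := n),
      (\<lambda>a. if a < (n + 1) * n then vec_index (p (a div n)) (a mod n) else 0))"

definition computes_strengths_within :: "prog \<Rightarrow> (nat \<Rightarrow> nat) \<Rightarrow> bool" where
  "computes_strengths_within c time \<longleftrightarrow>
     (\<forall>n\<ge>1. \<forall>p. simplex_points n p \<longrightarrow>
        (\<exists>t s. runs c (input_state n p) t s \<and> t \<le> time n \<and>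
           snd s 0 = strength n p \<and> snd s 1 = signed_strength n p))"

end

theory Submission
  imports Defs
begin

text \<open>
  Write \<open>D\<close> for the determinant of the edge matrix with columns \<open>p i - p 0\<close> and \<open>P\<close> for the
  half-perimeter. Everything rests on the formula \<open>\<bar>D\<bar> / n!\<close> for the volume of a simplex
  (\<open>volume_simplex_set\<close>), which makes the strength \<open>D\<^sup>2 / ((n!)\<^sup>2 * P ^ (2 * n - 1))\<close> and the signed
  strength the same with \<open>D * \<bar>D\<bar>\<close> in place of \<open>D\<^sup>2\<close>. The volume formula follows from the linear
  substitution rule for product Lebesgue measure: an invertible matrix is reduced to the identity by
  matrices that change a single coordinate, and for those Fubini's theorem reduces the rule to one
  dimension (\<open>nn_integral_linear_substitution\<close>).

  Invariance is then algebra. \<open>D\<^sup>2\<close> is the Gram determinant of the edge vectors, whose entries are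
  polynomials in the distances between vertices, so any isometry preserves the strength; translations
  do not change the edge matrix and rotations multiply it by a matrix of determinant \<open>1\<close>, so rigid
  motions also preserve the sign. Scaling by \<open>c\<close> multiplies \<open>D\<^sup>2\<close> by \<open>c ^ (2 * n)\<close> and the denominator
  by \<open>c ^ (2 * n - 1)\<close>.

  For the Lipschitz bounds, every edge is at most \<open>2 * P / n\<close> by the triangle inequality. Hadamard's
  inequality then gives \<open>\<bar>D\<bar> \<le> (2 * P / n) ^ n\<close>, and replacing the columns one by one it bounds the
  change of \<open>D\<close> by a multiple of \<open>\<epsilon> * P ^ (n - 1)\<close> when each vertex moves by at most \<open>\<epsilon>\<close>, while \<open>P\<close>
  changes by at most \<open>n * (n + 1) / 2 * \<epsilon>\<close>. In the difference of two strengths all powers of \<open>P\<close>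
  cancel if the larger half-perimeter is put into the denominator (\<open>quotient_perturbation\<close>), which
  leaves a constant multiple of \<open>\<epsilon>\<close>. For \<open>n \<ge> 3\<close> the constant is far below the required one, for
  triangles the sharper bound \<open>\<bar>D\<bar> \<le> 4 * P\<^sup>2 / 9\<close> brings it below \<open>\<surd>3\<close>, and for \<open>n = 1\<close> the signed
  strength is twice the signed length.

  The program sums the distances, subtracts the first vertex from the others, and brings the edge
  matrix to triangular form by row additions, which do not change the determinant. Each of these is a
  nest of at most three loops with at most \<open>n + 1\<close> rounds each (\<open>strength_prog_correct\<close>).
\<close>

section \<open>Substitution in product Lebesgue measure\<close>

abbreviation lborel_n :: "nat \<Rightarrow> (nat \<Rightarrow> real) measure" where
  "lborel_n n \<equiv> (\<Pi>\<^sub>M k\<in>{..<n}. (lborel :: real measure))"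

text \<open>
  By Fubini the integral over coordinate \<open>i\<close> can be done first; along that line \<open>g\<close> is constant, so the
  claim is the affine substitution rule for one-dimensional Lebesgue measure.
\<close>

lemma nn_integral_affine_coordinate:
  fixes f :: "(nat \<Rightarrow> real) \<Rightarrow> ennreal"
  assumes i: "i < n" and f [measurable]: "f \<in> borel_measurable (lborel_n n)"
    and g [measurable]: "g \<in> borel_measurable (lborel_n n)"
    and g_indep: "\<And>x y. g (x(i := y)) = g x" and a: "a \<noteq> 0"
  shows "ennreal \<bar>a\<bar> * (\<integral>\<^sup>+ x. f (x(i := a * x i + g x)) \<partial>lborel_n n) = (\<integral>\<^sup>+ x. f x \<partial>lborel_n n)"
proof -
  interpret product_sigma_finite "\<lambda>_::nat. lborel :: real measure" by standard
  let ?I = "{..<n} - {i}"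
  have I: "finite ?I" "i \<notin> ?I" and ins: "{..<n} = insert i ?I" using i by auto
  have upd [measurable]: "(\<lambda>x. x(i := a * x i + g x)) \<in> measurable (lborel_n n) (lborel_n n)"
    using i by (intro measurable_fun_upd[where J = "{..<n}"]) auto
  have m: "(\<lambda>x. f (x(i := a * x i + g x))) \<in> borel_measurable (lborel_n n)" by measurable
  have fub: "(\<integral>\<^sup>+ x. h x \<partial>lborel_n n) = (\<integral>\<^sup>+ x. (\<integral>\<^sup>+ y. h (x(i := y)) \<partial>lborel) \<partial>(\<Pi>\<^sub>M k\<in>?I. lborel))"
    if "h \<in> borel_measurable (lborel_n n)" for h :: "(nat \<Rightarrow> real) \<Rightarrow> ennreal"
    by (rule product_nn_integral_insert[OF I, folded ins, OF that])
  have "ennreal \<bar>a\<bar> * (\<integral>\<^sup>+ x. f (x(i := a * x i + g x)) \<partial>lborel_n n)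
      = (\<integral>\<^sup>+ x. ennreal \<bar>a\<bar> * f (x(i := a * x i + g x)) \<partial>lborel_n n)"
    by (rule nn_integral_cmult[symmetric]) measurable
  also have "\<dots> = (\<integral>\<^sup>+ x. (\<integral>\<^sup>+ y. ennreal \<bar>a\<bar> * f (x(i := g x + a * y)) \<partial>lborel) \<partial>(\<Pi>\<^sub>M k\<in>?I. lborel))"
  proof (subst fub)
    show "(\<lambda>x. ennreal \<bar>a\<bar> * f (x(i := a * x i + g x))) \<in> borel_measurable (lborel_n n)" by measurable
  qed (simp only: g_indep add.commute[of "g _"] fun_upd_same fun_upd_upd)
  also have "\<dots> = (\<integral>\<^sup>+ x. (\<integral>\<^sup>+ y. f (x(i := y)) \<partial>lborel) \<partial>(\<Pi>\<^sub>M k\<in>?I. lborel))"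
  proof (rule nn_integral_cong)
    fix x :: "nat \<Rightarrow> real" assume x: "x \<in> space (\<Pi>\<^sub>M k\<in>?I. lborel)"
    have "f \<circ> (\<lambda>y. x(i := y)) \<in> borel_measurable lborel"
      by (rule measurable_comp[OF measurable_component_update[OF x I(2), folded ins] f])
    then have "(\<lambda>y. f (x(i := y))) \<in> borel_measurable borel" by (simp add: comp_def)
    moreover from this have "(\<lambda>y. f (x(i := g x + a * y))) \<in> borel_measurable borel"
      using measurable_compose[of "\<lambda>y. g x + a * y" borel borel "\<lambda>y. f (x(i := y))" borel] by simp
    ultimately show "(\<integral>\<^sup>+ y. ennreal \<bar>a\<bar> * f (x(i := g x + a * y)) \<partial>lborel) = (\<integral>\<^sup>+ y. f (x(i := y)) \<partial>lborel)"
      using nn_integral_real_affine[of "\<lambda>y. f (x(i := y))" a "g x"] a by (simp add: nn_integral_cmult)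
  qed
  also have "\<dots> = (\<integral>\<^sup>+ x. f x \<partial>lborel_n n)"
    by (rule fub[OF f, symmetric])
  finally show ?thesis .
qed

definition lin_map :: "nat \<Rightarrow> real mat \<Rightarrow> (nat \<Rightarrow> real) \<Rightarrow> nat \<Rightarrow> real" where
  "lin_map n A x = (\<lambda>i\<in>{..<n}. vec_index (A *\<^sub>v Matrix.vec n x) i)"

lemma lin_map_index:
  assumes "A \<in> carrier_mat n n" "i < n"
  shows "lin_map n A x i = (\<Sum>j<n. A $$ (i,j) * x j)"
  using assms by (simp add: lin_map_def scalar_prod_def lessThan_atLeast0)

lemma lin_map_measurable [measurable]:
  assumes "A \<in> carrier_mat n n"
  shows "lin_map n A \<in> measurable (lborel_n n) (lborel_n n)"
proof -
  have "(\<lambda>x. \<lambda>i\<in>{..<n}. \<Sum>j<n. A $$ (i,j) * x j) \<in> measurable (lborel_n n) (lborel_n n)"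
    by (intro measurable_restrict) measurable
  moreover have "lin_map n A = (\<lambda>x. \<lambda>i\<in>{..<n}. \<Sum>j<n. A $$ (i,j) * x j)"
    using assms by (auto simp: fun_eq_iff lin_map_index) (simp add: lin_map_def)
  ultimately show ?thesis by simp
qed

lemma vec_lin_map:
  assumes "A \<in> carrier_mat n n"
  shows "Matrix.vec n (lin_map n A x) = A *\<^sub>v Matrix.vec n x"
  using assms by (intro eq_vecI) (auto simp: lin_map_def)

lemma lin_map_mult:
  assumes "A \<in> carrier_mat n n" "B \<in> carrier_mat n n"
  shows "lin_map n (A * B) x = lin_map n A (lin_map n B x)"
  using assms by (simp add: lin_map_def vec_lin_map[unfolded lin_map_def] assoc_mult_mat_vec[of _ n n _ n])

text \<open>
  The identity matrix with row \<open>i\<close> replaced by \<open>r\<close>. As a linear map it changes only coordinate \<open>i\<close>, so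
  it is a substitution in one variable; as a right factor it adds multiples of column \<open>i\<close> to the
  other columns, so it is an elimination step. Every invertible matrix is reduced to the identity by
  such factors.
\<close>

definition row_mat :: "nat \<Rightarrow> nat \<Rightarrow> (nat \<Rightarrow> real) \<Rightarrow> real mat" where
  "row_mat n i r = Matrix.mat n n (\<lambda>(a, b). if a = i then r b else if a = b then 1 else 0)"

lemma row_mat_carrier [simp]: "row_mat n i r \<in> carrier_mat n n"
  by (simp add: row_mat_def)

lemma mult_row_mat:
  assumes A: "A \<in> carrier_mat n n" and i: "i < n" and "a < n" "b < n"
  shows "(A * row_mat n i r) $$ (a,b) = (if b = i then 0 else A $$ (a,b)) + A $$ (a,i) * r b"
proof -
  have "(A * row_mat n i r) $$ (a,b) = (\<Sum>c<n. A $$ (a,c) * (if c = i then r b else if c = b then 1 else 0))"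
    using assms by (simp add: row_mat_def scalar_prod_def lessThan_atLeast0)
  also have "\<dots> = (\<Sum>c<n. (if c = b then (if b = i then 0 else A $$ (a,b)) else 0) + (if c = i then A $$ (a,i) * r b else 0))"
    by (rule sum.cong) auto
  also have "\<dots> = (if b = i then 0 else A $$ (a,b)) + A $$ (a,i) * r b"
    using assms by (simp add: sum.distrib)
  finally show ?thesis .
qed

text \<open>
  Starting from a diagonal matrix, the entries of row \<open>i\<close> are filled in one at a time by adding a
  multiple of a row that is a unit vector.
\<close>

lemma det_row_mat:
  assumes i: "i < n"
  shows "det (row_mat n i r) = r i"
proof -
  have "det (row_mat n i (\<lambda>b. if b < m \<or> b = i then r b else 0)) = r i" for m
  proof (induction m)
    case 0
    let ?R = "row_mat n i (\<lambda>b. if b < 0 \<or> b = i then r b else 0)"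
    have "det ?R = prod_list (diag_mat ?R)"
      by (rule det_lower_triangular[of n]) (auto simp: row_mat_def)
    also have "\<dots> = (\<Prod>a<n. ?R $$ (a,a))"
      by (simp add: diag_mat_def prod.list_conv_set_nth row_mat_def lessThan_atLeast0)
    also have "\<dots> = (\<Prod>a<n. if a = i then r i else 1)"
      by (rule prod.cong) (auto simp: row_mat_def)
    finally show ?case using i by simp
  next
    case (Suc m)
    show ?case
    proof (cases "m < n \<and> m \<noteq> i")
      case True
      have "row_mat n i (\<lambda>b. if b < Suc m \<or> b = i then r b else 0)
          = addrow (r m) i m (row_mat n i (\<lambda>b. if b < m \<or> b = i then r b else 0))"
        using True i by (intro eq_matI) (auto simp: row_mat_def less_Suc_eq)
      then show ?thesis using Suc True by (simp add: det_addrow[of _ n])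
    next
      case False
      then have "row_mat n i (\<lambda>b. if b < Suc m \<or> b = i then r b else 0) =
        row_mat n i (\<lambda>b. if b < m \<or> b = i then r b else 0)"
        by (intro eq_matI) (auto simp: row_mat_def less_Suc_eq)
      then show ?thesis using Suc by simp
    qed
  qed
  moreover have "row_mat n i (\<lambda>b. if b < n \<or> b = i then r b else 0) = row_mat n i r"
    by (intro eq_matI) (auto simp: row_mat_def)
  ultimately show ?thesis by metis
qed

lemma lin_map_row_mat:
  assumes i: "i < n" and x: "x \<in> space (lborel_n n)"
  shows "lin_map n (row_mat n i r) x = x(i := r i * x i + (\<Sum>j\<in>{..<n} - {i}. r j * x j))"
proof
  fix a
  show "lin_map n (row_mat n i r) x a = (x(i := r i * x i + (\<Sum>j\<in>{..<n} - {i}. r j * x j))) a"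
  proof (cases "a < n")
    case True
    have "lin_map n (row_mat n i r) x a = (\<Sum>j<n. (if a = i then r j else if a = j then 1 else 0) * x j)"
      using True by (simp add: lin_map_index) (simp add: row_mat_def)
    also have "\<dots> = (x(i := r i * x i + (\<Sum>j\<in>{..<n} - {i}. r j * x j))) a"
      using True i by (auto simp: sum.remove[of "{..<n}" i] if_distrib[of "\<lambda>c. c * _"] cong: if_cong)
    finally show ?thesis .
  next
    case False
    then show ?thesis using x i by (auto simp: lin_map_def space_PiM PiE_def extensional_def)
  qed
qed

definition scales_by_det :: "nat \<Rightarrow> real mat \<Rightarrow> bool" where
  "scales_by_det n A \<longleftrightarrow> (\<forall>f\<in>borel_measurable (lborel_n n).
     ennreal \<bar>det A\<bar> * (\<integral>\<^sup>+ x. f (lin_map n A x) \<partial>lborel_n n) = (\<integral>\<^sup>+ x. f x \<partial>lborel_n n))"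

text \<open>
  Both sides of the substitution rule for \<open>A\<close> and for the product differ by the same factor
  \<open>\<bar>r i\<bar>\<close>: on the integral it comes from the substitution in coordinate \<open>i\<close>, on the determinant from
  multiplicativity.
\<close>

lemma scales_by_det_cancel_row_mat:
  assumes A: "A \<in> carrier_mat n n" and i: "i < n" and r: "r i \<noteq> 0"
    and good: "scales_by_det n (A * row_mat n i r)"
  shows "scales_by_det n A"
  unfolding scales_by_det_def
proof
  fix f :: "(nat \<Rightarrow> real) \<Rightarrow> ennreal" assume f: "f \<in> borel_measurable (lborel_n n)"
  let ?R = "row_mat n i r" and ?h = "\<lambda>x. f (lin_map n A x)"
  have h: "?h \<in> borel_measurable (lborel_n n)"
    using f A by measurable
  have g: "(\<lambda>x. \<Sum>j\<in>{..<n} - {i}. r j * x j) \<in> borel_measurable (lborel_n n)"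
    by measurable
  have "(\<integral>\<^sup>+ x. ?h x \<partial>lborel_n n)
      = ennreal \<bar>r i\<bar> * (\<integral>\<^sup>+ x. ?h (x(i := r i * x i + (\<Sum>j\<in>{..<n} - {i}. r j * x j))) \<partial>lborel_n n)"
    by (rule nn_integral_affine_coordinate[OF i h g _ r, symmetric]) (auto intro!: sum.cong)
  also have "(\<integral>\<^sup>+ x. ?h (x(i := r i * x i + (\<Sum>j\<in>{..<n} - {i}. r j * x j))) \<partial>lborel_n n)
      = (\<integral>\<^sup>+ x. f (lin_map n (A * ?R) x) \<partial>lborel_n n)"
    using A i by (intro nn_integral_cong) (simp add: lin_map_mult[OF A] lin_map_row_mat)
  finally have "ennreal \<bar>det A\<bar> * (\<integral>\<^sup>+ x. ?h x \<partial>lborel_n n)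
      = ennreal \<bar>det (A * ?R)\<bar> * (\<integral>\<^sup>+ x. f (lin_map n (A * ?R) x) \<partial>lborel_n n)"
    using i by (simp add: det_mult[OF A] det_row_mat abs_mult ennreal_mult mult.assoc)
  also have "\<dots> = (\<integral>\<^sup>+ x. f x \<partial>lborel_n n)"
    using good f unfolding scales_by_det_def by (rule bspec)
  finally show "ennreal \<bar>det A\<bar> * (\<integral>\<^sup>+ x. ?h x \<partial>lborel_n n) = (\<integral>\<^sup>+ x. f x \<partial>lborel_n n)" .
qed

text \<open>
  Gaussian elimination on the columns, by downward induction on the number \<open>k\<close> of leading rows that
  are already unit vectors. Row \<open>k\<close> has a nonzero entry in some column \<open>i \<ge> k\<close>, since otherwise it
  would be a combination of the rows above it. If the diagonal entry vanishes, adding column \<open>i\<close> to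
  column \<open>k\<close> makes it nonzero; after that one right factor turns row \<open>k\<close> into a unit vector.
\<close>

lemma scales_by_det_if_unit_rows:
  assumes "k \<le> n" "A \<in> carrier_mat n n" "det A \<noteq> 0"
    and "\<And>a b. a < k \<Longrightarrow> b < n \<Longrightarrow> A $$ (a,b) = (if a = b then 1 else 0)"
  shows "scales_by_det n A"
  using assms
proof (induction k arbitrary: A rule: inc_induct)
  case base
  then have "A = 1\<^sub>m n" by (intro eq_matI) auto
  moreover have "lin_map n (1\<^sub>m n) x = x" if "x \<in> space (lborel_n n)" for x
    using that by (auto simp: lin_map_def space_PiM PiE_def extensional_def fun_eq_iff)
  ultimately show ?case by (auto simp: scales_by_det_def cong: nn_integral_cong)
next
  case (step k)
  note A = step.prems(1) and rows = step.prems(3)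
  have eliminate: "scales_by_det n B"
    if B: "B \<in> carrier_mat n n" "det B \<noteq> 0" "B $$ (k,k) \<noteq> 0"
      and rowsB: "\<And>a b. a < k \<Longrightarrow> b < n \<Longrightarrow> B $$ (a,b) = (if a = b then 1 else 0)" for B
  proof (rule scales_by_det_cancel_row_mat[OF B(1) \<open>k < n\<close>,
        where r = "\<lambda>b. if b = k then 1 / B $$ (k,k) else - B $$ (k,b) / B $$ (k,k)"])
    let ?r = "\<lambda>b. if b = k then 1 / B $$ (k,k) else - B $$ (k,b) / B $$ (k,k)"
    show "(if k = k then 1 / B $$ (k,k) else - B $$ (k,k) / B $$ (k,k)) \<noteq> 0" using B by simp
    show "scales_by_det n (B * row_mat n k ?r)"
    proof (rule step.IH)
      show "det (B * row_mat n k ?r) \<noteq> 0"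
        using B \<open>k < n\<close> by (simp add: det_mult[OF B(1)] det_row_mat)
      show "(B * row_mat n k ?r) $$ (a,b) = (if a = b then 1 else 0)" if "a < Suc k" "b < n" for a b
      proof (cases "a = k")
        case True
        then show ?thesis using that B(3) \<open>k < n\<close>
          by (cases "b = k") (simp_all add: mult_row_mat[OF B(1)])
      next
        case False
        then have "a < k" using that by simp
        then show ?thesis using that rowsB[of a b] rowsB[of a k] \<open>k < n\<close>
          by (auto simp: mult_row_mat[OF B(1)])
      qed
    qed (use B in simp)
  qed
  have "\<exists>i. k \<le> i \<and> i < n \<and> A $$ (k,i) \<noteq> 0"
  proof (rule ccontr)
    assume "\<not> ?thesis"
    then have zero: "A $$ (k,i) = 0" if "k \<le> i" "i < n" for i using that by blast
    \<comment> \<open>The coefficients of the combination form a left null vector of \<open>A\<close>.\<close>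
    let ?v = "Matrix.vec n (\<lambda>i. if i = k then 1 else if i < k then - A $$ (k,i) else 0)"
    have "vec_index (transpose_mat A *\<^sub>v ?v) b = 0" if b: "b < n" for b
    proof -
      have "vec_index (transpose_mat A *\<^sub>v ?v) b
          = (\<Sum>i<n. A $$ (i,b) * (if i = k then 1 else if i < k then - A $$ (k,i) else 0))"
        using A b by (simp add: scalar_prod_def lessThan_atLeast0)
      also have "\<dots> = (\<Sum>i<n. (if i = k then A $$ (k,b) else 0) + (if i = b then if b < k then - A $$ (k,b) else 0 else 0))"
        using rows b by (intro sum.cong) auto
      also have "\<dots> = 0" using b zero[of b] \<open>k < n\<close> by (simp add: sum.distrib)
      finally show ?thesis .
    qed
    then have "transpose_mat A *\<^sub>v ?v = 0\<^sub>v n" using A by (intro eq_vecI) auto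
    moreover have "vec_index ?v k \<noteq> vec_index (0\<^sub>v n) k" using \<open>k < n\<close> by simp
    then have "?v \<noteq> 0\<^sub>v n" by metis
    moreover have "?v \<in> carrier_vec n" by simp
    ultimately have "det (transpose_mat A) = 0"
      using det_0_iff_vec_prod_zero[of "transpose_mat A" n] A transpose_carrier_mat[of A n n] by blast
    then show False using step.prems(2) det_transpose[OF A] by metis
  qed
  then obtain i where i: "k \<le> i" "i < n" "A $$ (k,i) \<noteq> 0" by blast
  show ?case
  proof (cases "A $$ (k,k) = 0")
    case False
    then show ?thesis using eliminate[of A] step.prems by blast
  next
    case True
    then have "k < i" using i by (metis le_neq_implies_less)
    let ?r = "\<lambda>b. if b = k \<or> b = i then 1 else 0 :: real"
    show ?thesis
    proof (rule scales_by_det_cancel_row_mat[OF A i(2), where r = "\<lambda>b. if b = k \<or> b = i then 1 else 0"])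
      show "(if i = k \<or> i = i then 1 else 0 :: real) \<noteq> 0" by simp
      show "scales_by_det n (A * row_mat n i ?r)"
      proof (rule eliminate)
        show "det (A * row_mat n i ?r) \<noteq> 0"
          using step.prems i by (simp add: det_mult[OF A] det_row_mat)
        show "(A * row_mat n i ?r) $$ (k,k) \<noteq> 0"
          using True i \<open>k < n\<close> \<open>k < i\<close> by (simp add: mult_row_mat[OF A])
        show "(A * row_mat n i ?r) $$ (a,b) = (if a = b then 1 else 0)" if "a < k" "b < n" for a b
          using that rows[of a b] rows[of a i] i \<open>k < i\<close> by (auto simp: mult_row_mat[OF A])
      qed (use A in simp)
    qed
  qed
qed

lemma nn_integral_linear_substitution:
  assumes "A \<in> carrier_mat n n" "det A \<noteq> 0" "f \<in> borel_measurable (lborel_n n)"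
  shows "ennreal \<bar>det A\<bar> * (\<integral>\<^sup>+ x. f (lin_map n A x) \<partial>lborel_n n) = (\<integral>\<^sup>+ x. f x \<partial>lborel_n n)"
  using scales_by_det_if_unit_rows[of 0 n A] assms by (auto simp: scales_by_det_def)

text \<open>
  The coordinates are translated one after the other.
\<close>

lemma nn_integral_translation:
  assumes f: "f \<in> borel_measurable (lborel_n n)"
  shows "(\<integral>\<^sup>+ x. f (\<lambda>i\<in>{..<n}. x i + b i) \<partial>lborel_n n) = (\<integral>\<^sup>+ x. f x \<partial>lborel_n n)"
proof -
  let ?t = "\<lambda>k (x :: nat \<Rightarrow> real). \<lambda>i\<in>{..<n}. if i < k then x i + b i else x i"
  have t: "?t k \<in> measurable (lborel_n n) (lborel_n n)" for k
    by (intro measurable_restrict) measurable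
  have "(\<integral>\<^sup>+ x. f (?t k x) \<partial>lborel_n n) = (\<integral>\<^sup>+ x. f x \<partial>lborel_n n)" if "k \<le> n" for k
    using that
  proof (induction k)
    case 0
    have "?t 0 x = x" if "x \<in> space (lborel_n n)" for x
      using that by (auto simp: space_PiM PiE_def extensional_def fun_eq_iff)
    then show ?case by (intro nn_integral_cong) simp
  next
    case (Suc k)
    have "(\<integral>\<^sup>+ x. f (?t k x) \<partial>lborel_n n) = ennreal \<bar>1\<bar> * (\<integral>\<^sup>+ x. f (?t k (x(k := 1 * x k + b k))) \<partial>lborel_n n)"
      using Suc.prems
      by (intro nn_integral_affine_coordinate[symmetric] measurable_compose[OF t f]) auto
    also have "(\<integral>\<^sup>+ x. f (?t k (x(k := 1 * x k + b k))) \<partial>lborel_n n) = (\<integral>\<^sup>+ x. f (?t (Suc k) x) \<partial>lborel_n n)"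
      using Suc.prems by (intro nn_integral_cong arg_cong[where f = f]) (auto simp: fun_eq_iff less_Suc_eq)
    finally have "(\<integral>\<^sup>+ x. f (?t (Suc k) x) \<partial>lborel_n n) = (\<integral>\<^sup>+ x. f (?t k x) \<partial>lborel_n n)"
      by (simp only: abs_one ennreal_1 mult_1)
    then show ?case using Suc.IH Suc.prems by (metis Suc_leD)
  qed
  from this[of n] show ?thesis by (simp cong: restrict_cong)
qed

section \<open>Volume of a simplex\<close>

definition edge_mat :: "nat \<Rightarrow> (nat \<Rightarrow> real vec) \<Rightarrow> real mat" where
  "edge_mat n p = mat_of_cols n (map (\<lambda>i. p i - p 0) [1..<n+1])"

lemma edge_mat_carrier [simp]: "edge_mat n p \<in> carrier_mat n n"
  unfolding edge_mat_def by (rule carrier_matI) auto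

lemma edge_mat_dim [simp]: "dim_row (edge_mat n p) = n" "dim_col (edge_mat n p) = n"
  using edge_mat_carrier[of n p] by blast+

lemma edge_mat_index:
  assumes "simplex_points n p" "a < n" "b < n"
  shows "edge_mat n p $$ (a,b) = vec_index (p (Suc b)) a - vec_index (p 0) a"
proof -
  have "edge_mat n p $$ (a,b) = vec_index (p (Suc b) - p 0) a"
    unfolding edge_mat_def using assms by (subst mat_of_cols_index) (auto simp del: upt_Suc)
  also have "\<dots> = vec_index (p (Suc b)) a - vec_index (p 0) a"
    using assms by (subst index_minus_vec) (auto simp: simplex_points_def)
  finally show ?thesis .
qed

definition std_simplex :: "nat \<Rightarrow> (nat \<Rightarrow> real) set" where
  "std_simplex n = {x. (\<forall>i\<in>{..<n}. 0 \<le> x i) \<and> sum x {..<n} \<le> 1} \<inter> space (lborel_n n)"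

lemma emeasure_std_simplex_lborel_n: "emeasure (lborel_n n) (std_simplex n) = ennreal (1 / fact n)"
  using emeasure_std_simplex_aux[of "{..<n}" 1] by (simp add: std_simplex_def)

lemma std_simplex_sets [measurable]: "std_simplex n \<in> sets (lborel_n n)"
proof -
  have "std_simplex n = {x \<in> space (lborel_n n). (\<forall>i\<in>{..<n}. 0 \<le> x i) \<and> sum x {..<n} \<le> 1}"
    by (auto simp: std_simplex_def)
  also have "\<dots> \<in> sets (lborel_n n)" by measurable
  finally show ?thesis .
qed

lemma emeasure_coordinate_hyperplane:
  assumes "i < n"
  shows "emeasure (lborel_n n) {x \<in> space (lborel_n n). x i = c} = 0"
proof -
  interpret product_sigma_finite "\<lambda>_::nat. lborel :: real measure" by standard
  have "{x \<in> space (lborel_n n). x i = c} = (\<Pi>\<^sub>E j\<in>{..<n}. if j = i then {c} else UNIV)"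
    using assms by (auto simp: space_PiM PiE_def Pi_def extensional_def split: if_splits)
  also have "emeasure (lborel_n n) \<dots> = (\<Prod>j<n. emeasure lborel (if j = i then {c} else UNIV :: real set))"
    by (rule emeasure_PiM) auto
  also have "\<dots> = 0"
    using assms by (intro prod_zero) (auto intro!: bexI[of _ i])
  finally show ?thesis .
qed

text \<open>
  The matrix whose row \<open>i\<close> is \<open>w\<close> maps this hyperplane into a coordinate hyperplane, and linear
  substitutions preserve null sets.
\<close>

lemma emeasure_hyperplane:
  assumes i: "i < n" and w: "w i \<noteq> 0"
  shows "emeasure (lborel_n n) {x \<in> space (lborel_n n). (\<Sum>j<n. w j * x j) = c} = 0"
proof -
  let ?R = "row_mat n i w" and ?H = "{x \<in> space (lborel_n n). x i = c}"
  have "(\<lambda>x. x i) -` {c} \<inter> space (lborel_n n) \<in> sets (lborel_n n)"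
    by (rule measurable_sets[OF measurable_component_singleton[of i "{..<n}" "\<lambda>_. lborel"]]) (use i in auto)
  also have "(\<lambda>x. x i) -` {c} \<inter> space (lborel_n n) = ?H" by auto
  finally have H: "?H \<in> sets (lborel_n n)" .
  have Rx: "lin_map n ?R x \<in> ?H \<longleftrightarrow> (\<Sum>j<n. w j * x j) = c" if "x \<in> space (lborel_n n)" for x
    using i measurable_space[OF lin_map_measurable[OF row_mat_carrier, of n i w] that]
    by (simp add: lin_map_index) (simp add: row_mat_def)
  have "ennreal \<bar>w i\<bar> * (\<integral>\<^sup>+ x. indicator ?H (lin_map n ?R x) \<partial>lborel_n n) = (\<integral>\<^sup>+ x. indicator ?H x \<partial>lborel_n n)"
    using nn_integral_linear_substitution[of ?R n "indicator ?H"] i w H by (simp add: det_row_mat)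
  also have "\<dots> = 0" using H emeasure_coordinate_hyperplane[OF i] by simp
  finally have "(\<integral>\<^sup>+ x. indicator ?H (lin_map n ?R x) \<partial>lborel_n n) = 0" using w by simp
  also have "(\<integral>\<^sup>+ x. indicator ?H (lin_map n ?R x) \<partial>lborel_n n)
      = (\<integral>\<^sup>+ x. indicator {x \<in> space (lborel_n n). (\<Sum>j<n. w j * x j) = c} x \<partial>lborel_n n)"
    using Rx by (intro nn_integral_cong) (auto simp: indicator_def)
  also have "\<dots> = emeasure (lborel_n n) {x \<in> space (lborel_n n). (\<Sum>j<n. w j * x j) = c}"
    by (rule nn_integral_indicator) measurable
  finally show ?thesis .
qed

text \<open>
  The barycentric coordinate of \<open>p 0\<close> is determined by the others. Dropping it shows that the simplex
  is the affine image of the standard simplex under the edge matrix followed by a shift by \<open>p 0\<close>.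
\<close>

lemma simplex_set_iff_barycentric:
  assumes p: "simplex_points n p" and x: "x \<in> space (lborel_n n)"
  shows "Matrix.vec n x \<in> simplex_set n p \<longleftrightarrow>
    (\<exists>u\<in>std_simplex n. x = (\<lambda>i\<in>{..<n}. lin_map n (edge_mat n p) u i + vec_index (p 0) i))"
    (is "?L \<longleftrightarrow> (\<exists>u\<in>_. x = ?F u)")
proof
  have shift: "(\<Sum>i\<le>n. t i * vec_index (p i) k)
      = (\<Sum>j<n. edge_mat n p $$ (k,j) * t (Suc j)) + (\<Sum>i\<le>n. t i) * vec_index (p 0) k"
    if "k < n" for t :: "nat \<Rightarrow> real" and k
    using that p
    by (simp add: sum.atMost_shift edge_mat_index sum_distrib_left sum_distrib_right sum_subtractf
        algebra_simps sum.distrib)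
  {
    assume ?L
    then obtain t :: "nat \<Rightarrow> real" where t: "\<forall>i\<le>n. 0 \<le> t i \<and> t i \<le> 1" "(\<Sum>i\<le>n. t i) = 1"
      and xt: "Matrix.vec n x = Matrix.vec n (\<lambda>k. \<Sum>i\<le>n. t i * vec_index (p i) k)"
      unfolding simplex_set_def by blast
    define u where "u = (\<lambda>i\<in>{..<n}. t (Suc i))"
    have "u \<in> std_simplex n"
    proof -
      have "(\<Sum>i<n. u i) = (\<Sum>i<n. t (Suc i))" by (simp add: u_def)
      then show ?thesis
        using t(1)[rule_format, of 0] t by (auto simp: std_simplex_def u_def space_PiM sum.atMost_shift)
    qed
    moreover have "x = ?F u"
    proof
      fix k
      show "x k = ?F u k"
      proof (cases "k < n")
        case True
        then have "x k = (\<Sum>i\<le>n. t i * vec_index (p i) k)"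
          using arg_cong[OF xt, of "\<lambda>v. vec_index v k"] by simp
        then show ?thesis using True shift[OF True, of t] t(2) by (simp add: lin_map_index u_def)
      next
        case False
        then show ?thesis using x by (auto simp: space_PiM PiE_def extensional_def)
      qed
    qed
    ultimately show "\<exists>u\<in>std_simplex n. x = ?F u" by blast
  }
  {
    assume "\<exists>u\<in>std_simplex n. x = ?F u"
    then obtain u where u: "\<And>i. i < n \<Longrightarrow> 0 \<le> u i" "(\<Sum>i<n. u i) \<le> 1" and xu: "x = ?F u"
      by (auto simp: std_simplex_def)
    define t where "t i = (if i = 0 then 1 - (\<Sum>i<n. u i) else u (i - 1))" for i
    have sum1: "(\<Sum>i\<le>n. t i) = 1" by (simp add: t_def sum.atMost_shift)
    have nonneg: "0 \<le> t i" if "i \<le> n" for i using that u by (auto simp: t_def)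
    have "t i \<le> 1" if "i \<le> n" for i
      using member_le_sum[of i "{..n}" t] nonneg that sum1 by auto
    moreover have "Matrix.vec n x = Matrix.vec n (\<lambda>k. \<Sum>i\<le>n. t i * vec_index (p i) k)"
      using sum1 by (intro eq_vecI) (simp_all add: xu shift lin_map_index t_def)
    ultimately show ?L unfolding simplex_set_def using nonneg sum1 by blast
  }
qed

text \<open>
  If the edge matrix is invertible, the simplex is a measurable set whose indicator becomes that of
  the standard simplex after an affine substitution. If it is singular, the simplex lies in a
  null hyperplane, so its measure is \<open>0\<close>; monotonicity of \<^const>\<open>emeasure\<close> asks only the hyperplane to
  be measurable, as nonmeasurable sets have measure \<open>0\<close> by convention.
\<close>

lemma volume_simplex_set:
  assumes p: "simplex_points n p"
  shows "volume n (simplex_set n p) = \<bar>det (edge_mat n p)\<bar> / fact n"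
proof -
  let ?E = "edge_mat n p"
  let ?F = "\<lambda>u. \<lambda>i\<in>{..<n}. lin_map n ?E u i + vec_index (p 0) i"
  let ?G = "\<lambda>x. \<lambda>i\<in>{..<n}. x i + - vec_index (p 0) i"
  define T where "T = Matrix.vec n -` simplex_set n p \<inter> space (lborel_n n)"
  have T: "x \<in> T \<longleftrightarrow> x \<in> space (lborel_n n) \<and> (\<exists>u\<in>std_simplex n. x = ?F u)" for x
    using simplex_set_iff_barycentric[OF p, of x] by (auto simp: T_def)
  have "emeasure (lborel_n n) T = ennreal (\<bar>det ?E\<bar> / fact n)"
  proof (cases "det ?E = 0")
    case True
    then obtain w where w: "w \<in> carrier_vec n" "w \<noteq> 0\<^sub>v n" "transpose_mat ?E *\<^sub>v w = 0\<^sub>v n"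
      using det_0_iff_vec_prod_zero[of "transpose_mat ?E" n] det_transpose[of ?E n] by auto
    then obtain i where i: "i < n" "vec_index w i \<noteq> 0"
      by (metis carrier_vecD eq_vecI index_zero_vec)
    have orth: "(\<Sum>a<n. vec_index w a * lin_map n ?E u a) = 0" for u
    proof -
      have "(\<Sum>a<n. vec_index w a * lin_map n ?E u a) = (\<Sum>a<n. \<Sum>j<n. vec_index w a * ?E $$ (a,j) * u j)"
        by (simp add: lin_map_index sum_distrib_left mult.assoc)
      also have "\<dots> = (\<Sum>j<n. (\<Sum>a<n. ?E $$ (a,j) * vec_index w a) * u j)"
        by (subst sum.swap) (simp add: sum_distrib_right mult.commute[of "_ $$ _"])
      also have "\<dots> = (\<Sum>j<n. vec_index (transpose_mat ?E *\<^sub>v w) j * u j)"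
        using w(1) by (intro sum.cong) (auto simp: scalar_prod_def lessThan_atLeast0)
      also have "\<dots> = 0" using w by simp
      finally show ?thesis .
    qed
    let ?H = "{x \<in> space (lborel_n n). (\<Sum>a<n. vec_index w a * x a) = (\<Sum>a<n. vec_index w a * vec_index (p 0) a)}"
    have "T \<subseteq> ?H" using orth by (auto simp: T distrib_left sum.distrib)
    moreover have "?H \<in> sets (lborel_n n)" by measurable
    ultimately have "emeasure (lborel_n n) T \<le> emeasure (lborel_n n) ?H" by (rule emeasure_mono)
    then show ?thesis using True emeasure_hyperplane[of i n "vec_index w"] i by simp
  next
    case False
    then have "?E \<in> Units (ring_mat TYPE(real) n ())"
      by (intro det_non_zero_imp_unit) auto
    then obtain B where B: "B \<in> carrier_mat n n" "B * ?E = 1\<^sub>m n" "?E * B = 1\<^sub>m n"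
      by (auto simp: Units_def ring_mat_def)
    have one: "lin_map n (1\<^sub>m n) x = x" if "x \<in> space (lborel_n n)" for x
      using that by (auto simp: lin_map_def space_PiM PiE_def extensional_def fun_eq_iff)
    have lin_space: "lin_map n A x \<in> space (lborel_n n)" for A x
      by (auto simp: lin_map_def space_PiM)
    have lin_cong: "lin_map n A x = lin_map n A y" if "\<And>i. i < n \<Longrightarrow> x i = y i" for A x y
    proof -
      have "Matrix.vec n x = Matrix.vec n y" using that by (intro eq_vecI) auto
      then show ?thesis by (simp add: lin_map_def)
    qed
    have GF: "lin_map n B (?G (?F u)) = u" if "u \<in> space (lborel_n n)" for u
    proof -
      have "lin_map n B (?G (?F u)) = lin_map n B (lin_map n ?E u)" by (rule lin_cong) simp
      also have "\<dots> = u" using lin_map_mult[of B n ?E u] B one[OF that] by simp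
      finally show ?thesis .
    qed
    have FG: "?F (lin_map n B (?G x)) = x" if "x \<in> space (lborel_n n)" for x
    proof -
      have "lin_map n ?E (lin_map n B (?G x)) = ?G x"
        using lin_map_mult[of ?E n B "?G x"] B one[of "?G x"] by (auto simp: space_PiM)
      then show ?thesis using that by (auto simp: space_PiM PiE_def extensional_def fun_eq_iff)
    qed
    have G: "(\<lambda>x. lin_map n B (?G x)) \<in> measurable (lborel_n n) (lborel_n n)"
      by (intro measurable_compose[OF _ lin_map_measurable[OF B(1)]] measurable_restrict) measurable
    have T_eq: "T = (\<lambda>x. lin_map n B (?G x)) -` std_simplex n \<inter> space (lborel_n n)"
    proof (intro equalityI subsetI)
      fix x assume "x \<in> T"
      then obtain u where "x \<in> space (lborel_n n)" "u \<in> std_simplex n" "x = ?F u" by (auto simp: T)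
      then show "x \<in> (\<lambda>x. lin_map n B (?G x)) -` std_simplex n \<inter> space (lborel_n n)"
        using GF[of u] by (simp add: std_simplex_def)
    next
      fix x assume "x \<in> (\<lambda>x. lin_map n B (?G x)) -` std_simplex n \<inter> space (lborel_n n)"
      then have x: "x \<in> space (lborel_n n)" "lin_map n B (?G x) \<in> std_simplex n" by auto
      show "x \<in> T" unfolding T using x FG[OF x(1), symmetric] by blast
    qed
    have T_sets: "T \<in> sets (lborel_n n)"
      unfolding T_eq using measurable_sets[OF G std_simplex_sets] .
    have shifted: "(\<lambda>x. indicator T (\<lambda>i\<in>{..<n}. x i + vec_index (p 0) i) :: ennreal) \<in> borel_measurable (lborel_n n)"
      by (intro measurable_compose[OF _ borel_measurable_indicator[OF T_sets]] measurable_restrict) measurable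
    have "emeasure (lborel_n n) T = (\<integral>\<^sup>+ x. indicator T x \<partial>lborel_n n)"
      using T_sets by simp
    also have "\<dots> = (\<integral>\<^sup>+ x. indicator T (\<lambda>i\<in>{..<n}. x i + vec_index (p 0) i) \<partial>lborel_n n)"
      by (rule nn_integral_translation[symmetric]) (use T_sets in measurable)
    also have "\<dots> = ennreal \<bar>det ?E\<bar> * (\<integral>\<^sup>+ u. indicator T (?F u) \<partial>lborel_n n)"
      by (rule nn_integral_linear_substitution[symmetric, OF _ False shifted]) simp
    also have "(\<integral>\<^sup>+ u. indicator T (?F u) \<partial>lborel_n n) = (\<integral>\<^sup>+ u. indicator (std_simplex n) u \<partial>lborel_n n)"
    proof (intro nn_integral_cong)
      fix u assume u: "u \<in> space (lborel_n n)"
      have "?F u \<in> T \<longleftrightarrow> u \<in> std_simplex n"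
        unfolding T_eq using GF[OF u] by (simp add: space_PiM)
      then show "indicator T (?F u) = (indicator (std_simplex n) u :: ennreal)" by (simp add: indicator_def)
    qed
    also have "\<dots> = ennreal (1 / fact n)" by (simp add: emeasure_std_simplex_lborel_n)
    finally show ?thesis by (simp add: ennreal_mult[symmetric])
  qed
  then show ?thesis by (simp add: volume_def Let_def T_def measure_def)
qed

section \<open>Hadamard's inequality\<close>

definition row_dot :: "real mat \<Rightarrow> nat \<Rightarrow> nat \<Rightarrow> real" where
  "row_dot A i j = (\<Sum>k<dim_col A. A $$ (i,k) * A $$ (j,k))"

lemma row_dot_self_nonneg: "0 \<le> row_dot A i i"
  unfolding row_dot_def by (intro sum_nonneg) simp

lemma row_dot_commute: "row_dot A i j = row_dot A j i"
  by (simp add: row_dot_def mult.commute)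

text \<open>
  The Gram matrix \<open>A A\<^sup>T\<close> is diagonal.
\<close>

lemma det_square_eq_prod_if_orthogonal_rows:
  assumes A: "A \<in> carrier_mat n n"
    and orth: "\<And>i j. i < n \<Longrightarrow> j < n \<Longrightarrow> i \<noteq> j \<Longrightarrow> row_dot A i j = 0"
  shows "(det A)\<^sup>2 = (\<Prod>i<n. row_dot A i i)"
proof -
  let ?G = "A * transpose_mat A"
  have G: "?G $$ (i,j) = row_dot A i j" if "i < n" "j < n" for i j
    using A that by (simp add: row_dot_def scalar_prod_def lessThan_atLeast0)
  have "(det A)\<^sup>2 = det ?G" using A by (simp add: det_mult[of A n] det_transpose power2_eq_square)
  also have "\<dots> = prod_list (diag_mat ?G)"
    using A by (intro det_lower_triangular[of n]) (auto simp: G orth simp del: index_mult_mat(1))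
  also have "\<dots> = (\<Prod>i<n. row_dot A i i)"
    using A by (auto simp: diag_mat_def prod.list_conv_set_nth G lessThan_atLeast0 simp del: index_mult_mat(1)
        intro!: prod.cong)
  finally show ?thesis .
qed

text \<open>
  Gram--Schmidt orthogonalization, by downward induction on the number \<open>k\<close> of leading rows that are
  orthogonal to all other rows. Subtracting from every later row its projection to row \<open>k\<close> is a
  multiplication by a unitriangular matrix \<open>L\<close>: the determinant stays, the rows get shorter, and row
  \<open>k\<close> becomes orthogonal to all others.
\<close>

lemma hadamard_if_leading_rows_orthogonal:
  assumes "k \<le> n" "A \<in> carrier_mat n n"
    and "\<And>i j. i < k \<Longrightarrow> j < n \<Longrightarrow> i \<noteq> j \<Longrightarrow> row_dot A i j = 0"
  shows "(det A)\<^sup>2 \<le> (\<Prod>i<n. row_dot A i i)"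
  using assms
proof (induction k arbitrary: A rule: inc_induct)
  case base
  then show ?case by (simp add: det_square_eq_prod_if_orthogonal_rows)
next
  case (step k)
  note A = step.prems(1) and orth = step.prems(2)
  have dim: "dim_col A = n" "dim_row A = n" using A by auto
  \<comment> \<open>If row \<open>k\<close> is zero the coefficients are \<open>0 / 0 = 0\<close> and nothing has to be subtracted.\<close>
  define c where "c i = (if k < i then row_dot A i k / row_dot A k k else 0)" for i
  define L where "L = Matrix.mat n n (\<lambda>(i,j). (if i = j then 1 else 0) - (if j = k then c i else 0))"
  have L: "L \<in> carrier_mat n n" by (simp add: L_def)
  have "det L = prod_list (diag_mat L)"
    using L by (intro det_lower_triangular[of n]) (auto simp: L_def c_def)
  also have "\<dots> = (\<Prod>i<n. L $$ (i,i))"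
    using L by (simp add: diag_mat_def prod.list_conv_set_nth lessThan_atLeast0)
  also have "\<dots> = 1" by (rule prod.neutral) (auto simp: L_def c_def)
  finally have detL: "det L = 1" .
  have LA: "(L * A) $$ (i,j) = A $$ (i,j) - c i * A $$ (k,j)" if ij: "i < n" "j < n" for i j
  proof -
    have "(L * A) $$ (i,j) = (\<Sum>l<n. ((if i = l then 1 else 0) - (if l = k then c i else 0)) * A $$ (l,j))"
      using ij A by (simp add: L_def scalar_prod_def lessThan_atLeast0)
    also have "\<dots> = (\<Sum>l<n. (if i = l then A $$ (i,j) else 0) - (if l = k then c i * A $$ (k,j) else 0))"
      by (rule sum.cong) (auto simp: algebra_simps)
    also have "\<dots> = A $$ (i,j) - c i * A $$ (k,j)"
      using ij step.hyps by (simp add: sum_subtractf algebra_simps)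
    finally show ?thesis .
  qed
  have dot: "row_dot (L * A) i j
      = row_dot A i j - c j * row_dot A i k - c i * row_dot A k j + c i * c j * row_dot A k k"
    if "i < n" "j < n" for i j
  proof -
    have "row_dot (L * A) i j = (\<Sum>l<n. (A $$ (i,l) - c i * A $$ (k,l)) * (A $$ (j,l) - c j * A $$ (k,l)))"
      using that dim by (simp add: row_dot_def LA)
    also have "\<dots> = (\<Sum>l<n. A $$ (i,l) * A $$ (j,l) - c j * (A $$ (i,l) * A $$ (k,l))
        - c i * (A $$ (k,l) * A $$ (j,l)) + c i * c j * (A $$ (k,l) * A $$ (k,l)))"
      by (simp add: algebra_simps)
    also have "\<dots> = row_dot A i j - c j * row_dot A i k - c i * row_dot A k j + c i * c j * row_dot A k k"
      by (simp add: row_dot_def dim sum.distrib sum_subtractf sum_distrib_left)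
    finally show ?thesis .
  qed
  have zero: "row_dot A i k = 0" if "row_dot A k k = 0" for i
  proof -
    have "\<forall>l<n. A $$ (k,l) = 0"
      using that by (auto simp: row_dot_def dim sum_nonneg_eq_0_iff)
    then show ?thesis by (simp add: row_dot_def dim)
  qed
  have proj: "c i * row_dot A k k = row_dot A i k" if "k < i" for i
    using that zero[of i] by (auto simp: c_def)
  have "(det A)\<^sup>2 = (det (L * A))\<^sup>2" using detL by (simp add: det_mult[OF L A])
  also have "\<dots> \<le> (\<Prod>i<n. row_dot (L * A) i i)"
  proof (rule step.IH)
    show "L * A \<in> carrier_mat n n" using L A by simp
    fix i j assume ij: "i < Suc k" "j < n" "i \<noteq> j"
    show "row_dot (L * A) i j = 0"
    proof (cases "i = k")
      case True
      then have ck: "c k = 0" by (simp add: c_def)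
      show ?thesis
      proof (cases "k < j")
        case True
        then show ?thesis using \<open>i = k\<close> ij step.hyps proj[of j] by (simp add: dot ck row_dot_commute[of A k j])
      next
        case False
        then show ?thesis using \<open>i = k\<close> ij step.hyps orth[of j k]
          by (simp add: dot ck c_def row_dot_commute[of A k j])
      qed
    next
      case False
      then show ?thesis using ij step.hyps orth[of i j] orth[of i k] by (simp add: dot c_def)
    qed
  qed
  also have "\<dots> \<le> (\<Prod>i<n. row_dot A i i)"
  proof (intro prod_mono conjI)
    fix i assume "i \<in> {..<n}"
    show "0 \<le> row_dot (L * A) i i" by (rule row_dot_self_nonneg)
    show "row_dot (L * A) i i \<le> row_dot A i i"
    proof (cases "k < i")
      case True
      have "row_dot (L * A) i i = row_dot A i i - c i * c i * row_dot A k k"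
        using \<open>i \<in> _\<close> proj[OF True, symmetric] by (simp add: dot row_dot_commute[of A k i])
      then show ?thesis using row_dot_self_nonneg[of A k] by simp
    next
      case False
      then show ?thesis using \<open>i \<in> _\<close> by (simp add: dot c_def)
    qed
  qed
  finally show ?case .
qed

lemma hadamard_inequality:
  assumes A: "A \<in> carrier_mat n n"
  shows "\<bar>det A\<bar> \<le> (\<Prod>i<n. L2_set (\<lambda>k. A $$ (k,i)) {..<n})"
proof -
  let ?T = "transpose_mat A"
  have T: "?T \<in> carrier_mat n n" using A by simp
  have "(det A)\<^sup>2 \<le> (\<Prod>i<n. row_dot ?T i i)"
    using hadamard_if_leading_rows_orthogonal[of 0 n ?T] A det_transpose[OF A] by simp
  also have "\<dots> = (\<Prod>i<n. (L2_set (\<lambda>k. A $$ (k,i)) {..<n})\<^sup>2)"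
    using A by (intro prod.cong) (auto simp: row_dot_def L2_set_def sum_nonneg power2_eq_square[of "_ $$ _"])
  also have "\<dots> = (\<Prod>i<n. L2_set (\<lambda>k. A $$ (k,i)) {..<n})\<^sup>2" by (simp add: prod_power_distrib)
  finally show ?thesis by (rule abs_le_square_iff[THEN iffD2, THEN order_trans]) (simp add: prod_nonneg)
qed

section \<open>Isometries, rigid motions and scaling\<close>

abbreviation simplex_det :: "nat \<Rightarrow> (nat \<Rightarrow> real vec) \<Rightarrow> real" where
  "simplex_det n p \<equiv> det (edge_mat n p)"

lemma simplex_sign_eq: "simplex_sign n p = sgn (simplex_det n p)"
  by (simp only: simplex_sign_def edge_mat_def)

text \<open>
  The convention \<open>x / 0 = 0\<close> covers the case that all vertices coincide, because the exponent
  \<open>2 * n - 1\<close> is positive.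
\<close>

lemma strength_eq:
  assumes "n \<ge> 1" "simplex_points n p"
  shows "strength n p = (simplex_det n p)\<^sup>2 / (fact n)\<^sup>2 / half_perimeter n p ^ (2 * n - 1)"
  using assms by (simp add: strength_def volume_simplex_set power_divide)

lemma signed_strength_eq:
  assumes "n \<ge> 1" "simplex_points n p"
  shows "signed_strength n p
    = simplex_det n p * \<bar>simplex_det n p\<bar> / (fact n)\<^sup>2 / half_perimeter n p ^ (2 * n - 1)"
proof -
  have "sgn D * D\<^sup>2 = D * \<bar>D\<bar>" for D :: real
    by (simp add: power2_eq_square sgn_real_def)
  then show ?thesis
    unfolding signed_strength_def strength_eq[OF assms] simplex_sign_eq
    by (metis (no_types, lifting) times_divide_eq_right)
qed

lemma vnorm_diff:
  assumes "y \<in> carrier_vec n"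
  shows "vnorm (x - y) = L2_set (\<lambda>k. vec_index x k - vec_index y k) {..<n}"
  using assms unfolding vnorm_def by (auto intro!: L2_set_cong)

lemma vnorm_nonneg [simp]: "0 \<le> vnorm v"
  by (simp add: vnorm_def)

lemma vnorm_diff_commute:
  assumes "x \<in> carrier_vec n" "y \<in> carrier_vec n"
  shows "vnorm (x - y) = vnorm (y - x)"
  unfolding vnorm_diff[OF assms(1)] vnorm_diff[OF assms(2)]
  by (auto simp: L2_set_def power2_commute)

lemma vnorm_diff_triangle:
  assumes "x \<in> carrier_vec n" "y \<in> carrier_vec n" "z \<in> carrier_vec n"
  shows "vnorm (x - z) \<le> vnorm (x - y) + vnorm (y - z)"
  using L2_set_triangle_ineq[of "\<lambda>k. vec_index x k - vec_index y k" "\<lambda>k. vec_index y k - vec_index z k" "{..<n}"]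
  by (simp add: vnorm_diff[OF assms(2)] vnorm_diff[OF assms(3)])

text \<open>
  Polarization: inner products of edge vectors at \<open>p 0\<close> are polynomials in the distances between the
  vertices.
\<close>

lemma gram_entry_eq_distances:
  assumes p: "simplex_points n p" and ab: "a < n" "b < n"
  shows "(transpose_mat (edge_mat n p) * edge_mat n p) $$ (a,b)
    = ((vnorm (p (Suc a) - p 0))\<^sup>2 + (vnorm (p (Suc b) - p 0))\<^sup>2 - (vnorm (p (Suc a) - p (Suc b)))\<^sup>2) / 2"
proof -
  let ?x = "\<lambda>i. vec_index (p i)"
  have c: "p i \<in> carrier_vec n" if "i \<le> n" for i using p that by (simp add: simplex_points_def)
  have sq: "(vnorm (p i - p j))\<^sup>2 = (\<Sum>k<n. (?x i k - ?x j k)\<^sup>2)" if "j \<le> n" for i j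
    using vnorm_diff[OF c[OF that], of "p i"] by (simp add: L2_set_def sum_nonneg)
  have "(transpose_mat (edge_mat n p) * edge_mat n p) $$ (a,b)
      = (\<Sum>k<n. (?x (Suc a) k - ?x 0 k) * (?x (Suc b) k - ?x 0 k))"
    using ab p by (simp add: scalar_prod_def lessThan_atLeast0 edge_mat_index)
  also have "\<dots> = (\<Sum>k<n. ((?x (Suc a) k - ?x 0 k)\<^sup>2 + (?x (Suc b) k - ?x 0 k)\<^sup>2 - (?x (Suc a) k - ?x (Suc b) k)\<^sup>2) / 2)"
    by (rule sum.cong) (auto simp: power2_eq_square field_simps)
  also have "\<dots> = ((vnorm (p (Suc a) - p 0))\<^sup>2 + (vnorm (p (Suc b) - p 0))\<^sup>2 - (vnorm (p (Suc a) - p (Suc b)))\<^sup>2) / 2"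
    using ab by (simp add: sq sum.distrib sum_subtractf flip: sum_divide_distrib)
  finally show ?thesis .
qed

text \<open>
  The squared volume is the Gram determinant up to a constant factor, hence a function of the
  pairwise distances, and so is the half-perimeter.
\<close>

lemma strength_cong_distances:
  assumes n: "n \<ge> 1" and p: "simplex_points n p" and q: "simplex_points n q"
    and dist: "\<And>i j. i \<le> n \<Longrightarrow> j \<le> n \<Longrightarrow> vnorm (p i - p j) = vnorm (q i - q j)"
  shows "strength n p = strength n q"
proof -
  have "transpose_mat (edge_mat n p) * edge_mat n p = transpose_mat (edge_mat n q) * edge_mat n q"
    by (rule eq_matI) (auto simp: gram_entry_eq_distances[OF p] gram_entry_eq_distances[OF q] dist
        simp del: index_mult_mat(1))
  moreover have "det (transpose_mat (edge_mat n r) * edge_mat n r) = (simplex_det n r)\<^sup>2" for r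
    by (simp add: det_mult[of _ n] det_transpose[of _ n] power2_eq_square)
  ultimately have "(simplex_det n p)\<^sup>2 = (simplex_det n q)\<^sup>2" by metis
  moreover have "half_perimeter n p = half_perimeter n q"
    unfolding half_perimeter_def using dist by (auto intro!: sum.cong)
  ultimately show ?thesis by (simp add: strength_eq[OF n p] strength_eq[OF n q])
qed

lemma strength_isometry_invariant:
  assumes n: "n \<ge> 1" and p: "simplex_points n p" and f: "is_isometry n f"
  shows "strength n (\<lambda>i. f (p i)) = strength n p"
  using assms by (intro strength_cong_distances) (auto simp: is_isometry_def simplex_points_def)

lemma rotation_preserves_vnorm:
  assumes A: "A \<in> carrier_mat n n" and orth: "transpose_mat A * A = 1\<^sub>m n" and v: "v \<in> carrier_vec n"
  shows "vnorm (A *\<^sub>v v) = vnorm v"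
proof -
  have norm: "vnorm w = sqrt (scalar_prod w w)" for w
    by (simp add: vnorm_def L2_set_def scalar_prod_def lessThan_atLeast0 power2_eq_square)
  have "scalar_prod (A *\<^sub>v v) (A *\<^sub>v v) = scalar_prod (transpose_mat A *\<^sub>v (A *\<^sub>v v)) v"
    using A v by (simp add: transpose_vec_mult_scalar[of A n n])
  also have "transpose_mat A *\<^sub>v (A *\<^sub>v v) = v"
    using A v orth by (simp flip: assoc_mult_mat_vec[of _ n n _ n])
  finally show ?thesis by (simp add: norm)
qed

text \<open>
  Being an isometry is part of the induction, because a composition needs the inner map to keep the
  vertices in \<open>\<real>\<^sup>n\<close>.
\<close>

lemma rigid_motion_preserves:
  assumes "rigid_motion n f"
  shows "is_isometry n f \<and> (\<forall>p. simplex_points n p \<longrightarrow> simplex_det n (\<lambda>i. f (p i)) = simplex_det n p)"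
  using assms
proof induction
  case (translation b)
  have diff: "(x + b) - (y + b) = x - y" if "x \<in> carrier_vec n" "y \<in> carrier_vec n" for x y
    using that translation by (intro eq_vecI) auto
  have "edge_mat n (\<lambda>i. p i + b) = edge_mat n p" if "simplex_points n p" for p
    unfolding edge_mat_def using that diff by (auto simp: simplex_points_def intro!: arg_cong[where f = "mat_of_cols n"])
  then show ?case using diff translation by (auto simp: is_isometry_def)
next
  case (rotation A)
  have diff: "A *\<^sub>v x - A *\<^sub>v y = A *\<^sub>v (x - y)" if "x \<in> carrier_vec n" "y \<in> carrier_vec n" for x y
    using that rotation(1) by (simp add: mult_minus_distrib_mat_vec)
  have "edge_mat n (\<lambda>i. A *\<^sub>v p i) = A * edge_mat n p" if p: "simplex_points n p" for p
  proof (rule eq_matI)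
    fix a b assume ab: "a < dim_row (A * edge_mat n p)" "b < dim_col (A * edge_mat n p)"
    have p': "simplex_points n (\<lambda>i. A *\<^sub>v p i)" using p rotation(1) by (auto simp: simplex_points_def)
    have c: "p (Suc b) \<in> carrier_vec n" "p 0 \<in> carrier_vec n"
      using p ab rotation(1) by (auto simp: simplex_points_def)
    show "edge_mat n (\<lambda>i. A *\<^sub>v p i) $$ (a,b) = (A * edge_mat n p) $$ (a,b)"
      using ab rotation(1) c p
      by (simp add: edge_mat_index[OF p'] edge_mat_index scalar_prod_def right_diff_distrib sum_subtractf)
  qed (use rotation in auto)
  then have "simplex_det n (\<lambda>i. A *\<^sub>v p i) = simplex_det n p" if "simplex_points n p" for p
    using that rotation by (simp add: det_mult[of _ n])
  then show ?case
    using rotation diff by (auto simp: is_isometry_def rotation_preserves_vnorm)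
next
  case (composition f g)
  have "simplex_points n (\<lambda>i. g (p i))" if "simplex_points n p" for p
    using that composition by (auto simp: is_isometry_def simplex_points_def)
  then show ?case using composition by (auto simp: is_isometry_def)
qed

lemma signed_strength_rigid_invariant:
  assumes n: "n \<ge> 1" and p: "simplex_points n p" and f: "rigid_motion n f"
  shows "signed_strength n (\<lambda>i. f (p i)) = signed_strength n p"
proof -
  note preserves = rigid_motion_preserves[OF f]
  have "simplex_sign n (\<lambda>i. f (p i)) = simplex_sign n p"
    using preserves p by (simp add: simplex_sign_eq)
  then show ?thesis
    using strength_isometry_invariant[OF n p] preserves by (simp add: signed_strength_def)
qed

lemma edge_mat_scale:
  assumes "simplex_points n p"
  shows "edge_mat n (\<lambda>i. c \<cdot>\<^sub>v p i) = c \<cdot>\<^sub>m edge_mat n p"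
proof (rule eq_matI)
  fix a b assume "a < dim_row (c \<cdot>\<^sub>m edge_mat n p)" "b < dim_col (c \<cdot>\<^sub>m edge_mat n p)"
  moreover from this have "simplex_points n (\<lambda>i. c \<cdot>\<^sub>v p i)" "dim_vec (p (Suc b)) = n" "dim_vec (p 0) = n"
    using assms by (auto simp: simplex_points_def)
  ultimately show "edge_mat n (\<lambda>i. c \<cdot>\<^sub>v p i) $$ (a,b) = (c \<cdot>\<^sub>m edge_mat n p) $$ (a,b)"
    using assms by (simp add: edge_mat_index algebra_simps)
qed auto

text \<open>
  The squared volume scales with \<open>c ^ (2 * n)\<close> and the denominator with \<open>c ^ (2 * n - 1)\<close>.
\<close>

lemma strengths_scale:
  assumes n: "n \<ge> 1" and p: "simplex_points n p" and c: "c > 0"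
  shows "strength n (\<lambda>i. c \<cdot>\<^sub>v p i) = c * strength n p"
    and "signed_strength n (\<lambda>i. c \<cdot>\<^sub>v p i) = c * signed_strength n p"
proof -
  have p': "simplex_points n (\<lambda>i. c \<cdot>\<^sub>v p i)" using p by (auto simp: simplex_points_def)
  have "vnorm (c \<cdot>\<^sub>v p i - c \<cdot>\<^sub>v p j) = c * vnorm (p i - p j)" if "i \<le> n" "j \<le> n" for i j
  proof -
    have "p i \<in> carrier_vec n" "p j \<in> carrier_vec n" "dim_vec (p i) = n" "dim_vec (p j) = n" using p that by (auto simp: simplex_points_def)
    then have "vnorm (c \<cdot>\<^sub>v p i - c \<cdot>\<^sub>v p j)
        = L2_set (\<lambda>k. c * (vec_index (p i) k - vec_index (p j) k)) {..<n}"
      by (subst vnorm_diff[of _ n]) (auto simp: right_diff_distrib intro!: L2_set_cong)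
    also have "\<dots> = c * vnorm (p i - p j)"
      using L2_set_right_distrib[of c "\<lambda>k. vec_index (p i) k - vec_index (p j) k" "{..<n}"] c
        vnorm_diff[OF \<open>p j \<in> carrier_vec n\<close>] by simp
    finally show ?thesis .
  qed
  then have P: "half_perimeter n (\<lambda>i. c \<cdot>\<^sub>v p i) = c * half_perimeter n p"
    by (simp add: half_perimeter_def sum_distrib_left)
  have D: "simplex_det n (\<lambda>i. c \<cdot>\<^sub>v p i) = c ^ n * simplex_det n p"
    by (simp add: edge_mat_scale[OF p])
  have pow: "c ^ n * c ^ n = c * c ^ (2 * n - 1)"
    using n by (simp flip: power_add power_Suc add: mult_2)
  have "x * y * (c ^ n * c ^ n) / z / (c * h) ^ (2 * n - 1) = c * (x * y / z / h ^ (2 * n - 1))" for x y z h :: real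
    using c by (simp add: pow power_mult_distrib)
  note key = this[of "simplex_det n p" _ "(fact n)\<^sup>2" "half_perimeter n p"]
  show "strength n (\<lambda>i. c \<cdot>\<^sub>v p i) = c * strength n p"
    using key[of "simplex_det n p"]
    by (simp only: strength_eq[OF n p] strength_eq[OF n p'] P D power2_eq_square ac_simps)
  show "signed_strength n (\<lambda>i. c \<cdot>\<^sub>v p i) = c * signed_strength n p"
    using key[of "\<bar>simplex_det n p\<bar>"] c
    by (simp add: signed_strength_eq[OF n p] signed_strength_eq[OF n p'] P D abs_mult ac_simps)
qed

section \<open>Lipschitz continuity\<close>

lemma sum_symmetric_double:
  fixes d :: "nat \<Rightarrow> nat \<Rightarrow> real"
  assumes "\<And>i j. i \<le> n \<Longrightarrow> j \<le> n \<Longrightarrow> d i j = d j i" "\<And>i. i \<le> n \<Longrightarrow> d i i = 0"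
  shows "(\<Sum>i\<le>n. \<Sum>j\<le>n. d i j) = 2 * (\<Sum>j\<le>n. \<Sum>i<j. d i j)"
  using assms
proof (induction n)
  case (Suc n)
  have "(\<Sum>j\<le>n. d (Suc n) j) = (\<Sum>i\<le>n. d i (Suc n))"
    using Suc.prems by (intro sum.cong) auto
  moreover have "(\<Sum>i\<le>n. \<Sum>j\<le>n. d i j) = 2 * (\<Sum>j\<le>n. \<Sum>i<j. d i j)"
    using Suc by simp
  ultimately show ?case
    using Suc.prems(2)[of "Suc n"] by (simp add: sum.distrib lessThan_Suc_atMost)
qed simp

text \<open>
  Going from \<open>p a\<close> to \<open>p b\<close> through any of the other \<open>n - 1\<close> vertices costs at least the length of
  the edge. These paths and the edge itself have no edge in common, so \<open>n\<close> times the edge is at most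
  the sum of all edges. The proof counts every edge in both directions.
\<close>

lemma simplex_edge_le_half_perimeter:
  assumes p: "simplex_points n p" and ab: "a \<le> n" "b \<le> n" "a \<noteq> b"
  shows "n * vnorm (p a - p b) \<le> 2 * half_perimeter n p"
proof -
  let ?d = "\<lambda>i j. vnorm (p i - p j)"
  have c: "p i \<in> carrier_vec n" if "i \<le> n" for i using p that by (simp add: simplex_points_def)
  have "{a,b} \<subseteq> {..n}" using ab by auto
  have tri: "?d a b \<le> ?d i a + ?d i b" if "i \<le> n" for i
    using vnorm_diff_triangle[OF c[OF ab(1)] c[OF that] c[OF ab(2)]] vnorm_diff_commute[OF c[OF ab(1)] c[OF that]]
    by simp
  have row: "?d a b \<le> (\<Sum>j\<le>n. ?d i j)" if "i \<le> n" for i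
  proof -
    have "?d a b \<le> (\<Sum>j\<in>{a,b}. ?d i j)" using tri[OF that] ab by simp
    also have "\<dots> \<le> (\<Sum>j\<le>n. ?d i j)" using ab by (intro sum_mono2) auto
    finally show ?thesis .
  qed
  have "(\<Sum>j\<le>n. ?d a b) \<le> (\<Sum>j\<le>n. ?d a j + ?d b j)"
    using tri by (intro sum_mono) (metis atMost_iff ab c vnorm_diff_commute)
  then have two_rows: "(n + 1) * ?d a b \<le> (\<Sum>i\<in>{a,b}. \<Sum>j\<le>n. ?d i j)"
    using ab by (simp add: sum.distrib)
  have "card ({..n} - {a,b}) = n - 1" using ab by (simp add: card_Diff_subset)
  moreover have "n \<ge> 1" using ab by linarith
  ultimately have "(real n - 1) * ?d a b = (\<Sum>i\<in>{..n} - {a,b}. ?d a b)"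
    by (simp add: of_nat_diff)
  also have "\<dots> \<le> (\<Sum>i\<in>{..n} - {a,b}. \<Sum>j\<le>n. ?d i j)" using row by (intro sum_mono) auto
  finally have "(n + 1) * ?d a b + (real n - 1) * ?d a b \<le> (\<Sum>i\<le>n. \<Sum>j\<le>n. ?d i j)"
    using two_rows sum.subset_diff[OF \<open>{a,b} \<subseteq> {..n}\<close>, of "\<lambda>i. \<Sum>j\<le>n. ?d i j"] by simp
  also have "\<dots> = 4 * half_perimeter n p"
    using sum_symmetric_double[of n ?d] vnorm_diff_commute[OF c c] vnorm_diff[OF c, of _ "p _"]
    by (simp add: half_perimeter_def L2_set_def)
  finally show ?thesis by (simp add: algebra_simps)
qed

lemma vnorm_diff_perturbation:
  assumes p: "simplex_points n p" and q: "simplex_points n q"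
    and close: "\<And>i. i \<le> n \<Longrightarrow> vnorm (p i - q i) \<le> \<epsilon>" and ij: "i \<le> n" "j \<le> n"
  shows "L2_set (\<lambda>k. (vec_index (p i) k - vec_index (p j) k) - (vec_index (q i) k - vec_index (q j) k)) {..<n} \<le> 2 * \<epsilon>"
proof -
  let ?e = "\<lambda>i k. vec_index (p i) k - vec_index (q i) k"
  have c: "q i \<in> carrier_vec n" if "i \<le> n" for i using q that by (simp add: simplex_points_def)
  have "L2_set (\<lambda>k. ?e i k + - ?e j k) {..<n} \<le> L2_set (?e i) {..<n} + L2_set (\<lambda>k. - ?e j k) {..<n}"
    by (rule L2_set_triangle_ineq)
  also have "L2_set (\<lambda>k. - ?e j k) {..<n} = L2_set (?e j) {..<n}"
    by (simp add: L2_set_def power2_commute)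
  also have "L2_set (?e i) {..<n} + L2_set (?e j) {..<n} \<le> 2 * \<epsilon>"
    using close[OF ij(1)] close[OF ij(2)] by (simp add: vnorm_diff[OF c[OF ij(1)]] vnorm_diff[OF c[OF ij(2)]])
  finally show ?thesis by (simp add: algebra_simps)
qed

lemma half_perimeter_perturbation:
  assumes p: "simplex_points n p" and q: "simplex_points n q"
    and close: "\<And>i. i \<le> n \<Longrightarrow> vnorm (p i - q i) \<le> \<epsilon>"
  shows "half_perimeter n p - half_perimeter n q \<le> real n * (real n + 1) / 2 * \<epsilon>"
proof -
  have c: "p i \<in> carrier_vec n" "q i \<in> carrier_vec n" if "i \<le> n" for i
    using p q that by (auto simp: simplex_points_def)
  have edge: "vnorm (p i - p j) - vnorm (q i - q j) \<le> 2 * \<epsilon>" if ij: "i \<le> n" "j \<le> n" for i j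
  proof -
    have "vnorm (p i - p j) = L2_set (\<lambda>k. (vec_index (q i) k - vec_index (q j) k)
        + ((vec_index (p i) k - vec_index (p j) k) - (vec_index (q i) k - vec_index (q j) k))) {..<n}"
      by (simp add: vnorm_diff[OF c(1)[OF ij(2)]])
    also have "\<dots> \<le> vnorm (q i - q j) + L2_set (\<lambda>k. (vec_index (p i) k - vec_index (p j) k) - (vec_index (q i) k - vec_index (q j) k)) {..<n}"
      unfolding vnorm_diff[OF c(2)[OF ij(2)]] by (rule L2_set_triangle_ineq)
    finally show ?thesis using vnorm_diff_perturbation[OF p q close ij] by linarith
  qed
  have "half_perimeter n p - half_perimeter n q = 1/2 * (\<Sum>j\<le>n. \<Sum>i<j. vnorm (p i - p j) - vnorm (q i - q j))"
    by (simp add: half_perimeter_def sum_subtractf algebra_simps)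
  also have "\<dots> \<le> 1/2 * (\<Sum>j\<le>n. \<Sum>i<j. 2 * \<epsilon>)"
    using edge by (intro mult_left_mono sum_mono) auto
  also have "\<dots> = real n * (real n + 1) / 2 * \<epsilon>"
    using double_gauss_sum[of n, where ?'a = real] by (simp flip: sum_distrib_right add: atMost_atLeast0)
  finally show ?thesis .
qed

text \<open>
  In a telescoping sum over the columns one column is a short difference of vectors and the others
  are edges, hence the separate bound for one column.
\<close>

lemma hadamard_column_bound:
  assumes A: "A \<in> carrier_mat n n" and m: "m < n"
    and M: "\<And>i. i < n \<Longrightarrow> i \<noteq> m \<Longrightarrow> L2_set (\<lambda>k. A $$ (k,i)) {..<n} \<le> M"
    and d: "L2_set (\<lambda>k. A $$ (k,m)) {..<n} \<le> d"
  shows "\<bar>det A\<bar> \<le> d * M ^ (n - 1)"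
proof -
  have "\<bar>det A\<bar> \<le> (\<Prod>i<n. L2_set (\<lambda>k. A $$ (k,i)) {..<n})" by (rule hadamard_inequality[OF A])
  also have "\<dots> \<le> (\<Prod>i<n. if i = m then d else M)"
    using M d by (intro prod_mono) auto
  also have "\<dots> = d * (\<Prod>i\<in>{..<n} - {m}. M)"
    using m by (subst prod.remove[of _ m]) (auto intro!: prod.cong)
  also have "\<dots> = d * M ^ (n - 1)" using m by simp
  finally show ?thesis .
qed

text \<open>
  Replacing the columns of \<open>A\<close> by those of \<open>B\<close> one after the other gives a telescoping sum of \<open>n\<close>
  differences. By linearity in column \<open>m\<close> (its cofactors do not depend on it) each difference is the
  determinant of a matrix with one short column, which Hadamard's inequality bounds.
\<close>

lemma det_column_perturbation:
  assumes A: "A \<in> carrier_mat n n" and B: "B \<in> carrier_mat n n"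
    and MA: "\<And>i. i < n \<Longrightarrow> L2_set (\<lambda>k. A $$ (k,i)) {..<n} \<le> M"
    and MB: "\<And>i. i < n \<Longrightarrow> L2_set (\<lambda>k. B $$ (k,i)) {..<n} \<le> M"
    and d: "\<And>i. i < n \<Longrightarrow> L2_set (\<lambda>k. A $$ (k,i) - B $$ (k,i)) {..<n} \<le> d"
  shows "\<bar>det A - det B\<bar> \<le> n * d * M ^ (n - 1)"
proof -
  \<comment> \<open>The first \<open>m\<close> columns have been replaced.\<close>
  define H where "H m = Matrix.mat n n (\<lambda>(k,i). if i < m then B $$ (k,i) else A $$ (k,i))" for m
  have H: "H m \<in> carrier_mat n n" for m by (simp add: H_def)
  have "\<bar>det A - det (H m)\<bar> \<le> m * (d * M ^ (n - 1))" if "m \<le> n" for m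
    using that
  proof (induction m)
    case 0
    have "H 0 = A" using A by (intro eq_matI) (auto simp: H_def)
    then show ?case by simp
  next
    case (Suc m)
    then have m: "m < n" by simp
    define Z where "Z = Matrix.mat n n (\<lambda>(k,i). if i = m then A $$ (k,i) - B $$ (k,i) else H m $$ (k,i))"
    have Z: "Z \<in> carrier_mat n n" by (simp add: Z_def)
    have cof: "cofactor (H (Suc m)) i m = cofactor (H m) i m" "cofactor Z i m = cofactor (H m) i m"
      if "i < n" for i
    proof -
      have "mat_delete (H (Suc m)) i m = mat_delete (H m) i m" "mat_delete Z i m = mat_delete (H m) i m"
        using m that by (auto intro!: eq_matI simp: mat_delete_def H_def Z_def)
      then show "cofactor (H (Suc m)) i m = cofactor (H m) i m" "cofactor Z i m = cofactor (H m) i m"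
        by (simp_all add: cofactor_def)
    qed
    have "det (H m) - det (H (Suc m)) = det Z"
      unfolding laplace_expansion_column[OF H m] laplace_expansion_column[OF Z m]
      using m by (simp add: cof flip: sum_subtractf) (simp add: H_def Z_def algebra_simps)
    moreover have "\<bar>det Z\<bar> \<le> d * M ^ (n - 1)"
    proof (rule hadamard_column_bound[OF Z m])
      have "L2_set (\<lambda>k. Z $$ (k,m)) {..<n} = L2_set (\<lambda>k. A $$ (k,m) - B $$ (k,m)) {..<n}"
        using m by (intro L2_set_cong) (auto simp: Z_def)
      then show "L2_set (\<lambda>k. Z $$ (k,m)) {..<n} \<le> d" using d[OF m] by simp
      show "L2_set (\<lambda>k. Z $$ (k,i)) {..<n} \<le> M" if "i < n" "i \<noteq> m" for i
      proof -
        have "L2_set (\<lambda>k. Z $$ (k,i)) {..<n} = L2_set (\<lambda>k. (if i < m then B else A) $$ (k,i)) {..<n}"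
          using that by (intro L2_set_cong) (auto simp: Z_def H_def)
        then show ?thesis using MA[OF that(1)] MB[OF that(1)] by simp
      qed
    qed
    moreover have "\<bar>det A - det (H m)\<bar> \<le> m * (d * M ^ (n - 1))" using Suc by simp
    ultimately show ?case by (simp add: algebra_simps)
  qed
  from this[of n] have "\<bar>det A - det (H n)\<bar> \<le> n * (d * M ^ (n - 1))" by simp
  moreover have "H n = B" using B by (intro eq_matI) (auto simp: H_def)
  ultimately show ?thesis by (simp add: mult.assoc)
qed

lemma edge_mat_column_norm:
  assumes p: "simplex_points n p" and i: "i < n"
  shows "L2_set (\<lambda>k. edge_mat n p $$ (k,i)) {..<n} = vnorm (p (Suc i) - p 0)"
  using assms by (subst vnorm_diff[of _ n]) (auto simp: simplex_points_def edge_mat_index intro!: L2_set_cong)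

lemma simplex_det_bound:
  assumes p: "simplex_points n p" and n: "n \<ge> 1"
  shows "\<bar>simplex_det n p\<bar> \<le> (2 / n) ^ n * half_perimeter n p ^ n"
proof -
  have col: "L2_set (\<lambda>k. edge_mat n p $$ (k,i)) {..<n} \<le> 2 / n * half_perimeter n p" if "i < n" for i
    using simplex_edge_le_half_perimeter[OF p, of "Suc i" 0] that n
    by (simp add: edge_mat_column_norm[OF p] field_simps)
  have "\<bar>simplex_det n p\<bar> \<le> (2 / n * half_perimeter n p) * (2 / n * half_perimeter n p) ^ (n - 1)"
    using n col by (intro hadamard_column_bound[of _ n 0]) auto
  also have "\<dots> = (2 / n * half_perimeter n p) ^ n" using n by (simp flip: power_Suc)
  also have "\<dots> = (2 / n) ^ n * half_perimeter n p ^ n" by (rule power_mult_distrib)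
  finally show ?thesis .
qed

lemma simplex_det_perturbation:
  assumes p: "simplex_points n p" and q: "simplex_points n q" and n: "n \<ge> 1"
    and close: "\<And>i. i \<le> n \<Longrightarrow> vnorm (p i - q i) \<le> \<epsilon>"
    and le: "half_perimeter n q \<le> half_perimeter n p"
  shows "\<bar>simplex_det n p - simplex_det n q\<bar> \<le> (2 * real n * (2 / real n) ^ (n - 1)) * \<epsilon> * half_perimeter n p ^ (n - 1)"
proof -
  have "\<bar>simplex_det n p - simplex_det n q\<bar> \<le> n * (2 * \<epsilon>) * (2 / n * half_perimeter n p) ^ (n - 1)"
  proof (rule det_column_perturbation)
    fix i assume i: "i < n"
    show "L2_set (\<lambda>k. edge_mat n p $$ (k,i)) {..<n} \<le> 2 / n * half_perimeter n p"
      using simplex_edge_le_half_perimeter[OF p, of "Suc i" 0] i n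
      by (simp add: edge_mat_column_norm[OF p] field_simps)
    show "L2_set (\<lambda>k. edge_mat n q $$ (k,i)) {..<n} \<le> 2 / n * half_perimeter n p"
      using simplex_edge_le_half_perimeter[OF q, of "Suc i" 0] i n le
      by (simp add: edge_mat_column_norm[OF q] field_simps)
    have "L2_set (\<lambda>k. edge_mat n p $$ (k,i) - edge_mat n q $$ (k,i)) {..<n}
      = L2_set (\<lambda>k. (vec_index (p (Suc i)) k - vec_index (p 0) k) - (vec_index (q (Suc i)) k - vec_index (q 0) k)) {..<n}"
      using i by (intro L2_set_cong) (auto simp: edge_mat_index[OF p] edge_mat_index[OF q])
    then show "L2_set (\<lambda>k. edge_mat n p $$ (k,i) - edge_mat n q $$ (k,i)) {..<n} \<le> 2 * \<epsilon>"
      using vnorm_diff_perturbation[OF p q close, of "Suc i" 0] i by simp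
  qed simp_all
  then show ?thesis by (simp only: power_mult_distrib mult_ac)
qed

text \<open>
  The bound \<open>P\<^sup>2\<close> that Hadamard's inequality gives for triangles from \<open>simplex_det_bound\<close> is too weak
  for the Lipschitz constant \<open>\<surd>3\<close>. Applying Hadamard's inequality at each of the three vertices bounds
  the determinant by every product of two sides, hence by their mean \<open>(ab + bc + ca) / 3\<close>, which is
  at most \<open>(a + b + c)\<^sup>2 / 9\<close>.
\<close>

lemma triangle_det_bound:
  assumes p: "simplex_points 2 p"
  shows "\<bar>simplex_det 2 p\<bar> \<le> 4 / 9 * half_perimeter 2 p ^ 2"
proof -
  let ?E = "edge_mat 2 p"
  let ?a = "vnorm (p 1 - p 0)" and ?b = "vnorm (p 2 - p 0)" and ?c = "vnorm (p 2 - p 1)"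
  have c: "p i \<in> carrier_vec 2" if "i \<le> 2" for i using p that by (simp add: simplex_points_def)
  have two: "{..<2::nat} = {0,1}" by auto
  have had: "\<bar>det A\<bar> \<le> L2_set (\<lambda>k. A $$ (k,0)) {..<2} * L2_set (\<lambda>k. A $$ (k,1)) {..<2}"
    if "A \<in> carrier_mat 2 2" for A :: "real mat"
    using hadamard_inequality[OF that] by (simp add: two)
  have col: "L2_set (\<lambda>k. ?E $$ (k,0)) {..<2} = ?a" "L2_set (\<lambda>k. ?E $$ (k,1)) {..<2} = ?b"
    using edge_mat_column_norm[OF p, of 0] edge_mat_column_norm[OF p, of 1] by (simp_all add: numeral_2_eq_2)
  have entries: "?E $$ (k,0) = vec_index (p 1) k - vec_index (p 0) k"
    "?E $$ (k,1) = vec_index (p 2) k - vec_index (p 0) k" if "k < 2" for k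
    using edge_mat_index[OF p that, of 0] edge_mat_index[OF p that, of 1, unfolded Suc_1] by simp_all
  have third: "L2_set (\<lambda>k. ?E $$ (k,1) - ?E $$ (k,0)) {..<2} = ?c"
    "L2_set (\<lambda>k. ?E $$ (k,0) - ?E $$ (k,1)) {..<2} = ?c"
    using c by (auto simp: vnorm_diff[of _ 2] entries[simplified] power2_commute L2_set_def)
  have ab: "\<bar>det ?E\<bar> \<le> ?a * ?b" using had[of ?E] col by simp
  \<comment> \<open>Subtracting one column from the other replaces a side at \<open>p 0\<close> by the side opposite to \<open>p 0\<close>.\<close>
  have ac: "\<bar>det ?E\<bar> \<le> ?a * ?c"
  proof -
    let ?A = "addcol (-1) 1 0 ?E"
    have A: "?A \<in> carrier_mat 2 2" by (rule carrier_matI) simp_all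
    have "L2_set (\<lambda>k. ?A $$ (k,0)) {..<2} = ?a"
      by (subst col(1)[symmetric], rule L2_set_cong) auto
    moreover have "L2_set (\<lambda>k. ?A $$ (k,1)) {..<2} = ?c"
      by (subst third(1)[symmetric], rule L2_set_cong) auto
    ultimately show ?thesis
      using had[OF A] det_addcol[of 0 2 1 ?E "-1"] by (simp only: edge_mat_carrier)
  qed
  have cb: "\<bar>det ?E\<bar> \<le> ?c * ?b"
  proof -
    let ?A = "addcol (-1) 0 1 ?E"
    have A: "?A \<in> carrier_mat 2 2" by (rule carrier_matI) simp_all
    have "L2_set (\<lambda>k. ?A $$ (k,1)) {..<2} = ?b"
      by (subst col(2)[symmetric], rule L2_set_cong) auto
    moreover have "L2_set (\<lambda>k. ?A $$ (k,0)) {..<2} = ?c"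
      by (subst third(2)[symmetric], rule L2_set_cong) auto
    ultimately show ?thesis
      using had[OF A] det_addcol[of 1 2 0 ?E "-1"] by (simp only: edge_mat_carrier)
  qed
  have P: "half_perimeter 2 p = (?a + ?b + ?c) / 2"
    by (simp add: half_perimeter_def numeral_2_eq_2 vnorm_diff_commute[OF c c])
  have "3 * \<bar>det ?E\<bar> \<le> ?a * ?b + ?a * ?c + ?c * ?b" using ab ac cb by linarith
  also have "\<dots> \<le> (?a + ?b + ?c)\<^sup>2 / 3"
    using zero_le_power2[of "?a - ?b"] zero_le_power2[of "?b - ?c"] zero_le_power2[of "?a - ?c"]
    by (simp add: power2_eq_square algebra_simps)
  finally show ?thesis by (simp add: P power_divide)
qed

text \<open>
  The core of the Lipschitz estimate. The primed quantities belong to the simplex with the smaller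
  half-perimeter. The difference of the quotients splits into a change of the numerator over the
  larger denominator, where the powers of \<open>P\<close> cancel exactly, and a change of the denominator, which
  Bernoulli's inequality \<open>1 - x ^ m \<le> m * (1 - x)\<close> at \<open>x = P' / P\<close> turns into the difference of the
  half-perimeters. The argument is algebraic, so it covers coinciding
  vertices, where the half-perimeter is not differentiable.
\<close>

lemma quotient_perturbation:
  fixes D D' P P' K L G \<epsilon> :: real and g :: "real \<Rightarrow> real"
  assumes n: "n \<ge> 1" and P: "0 \<le> P'" "P' \<le> P" and \<epsilon>: "0 \<le> \<epsilon>" and LG: "0 \<le> L" "0 \<le> G" and K: "0 \<le> K"
    and D: "\<bar>D\<bar> \<le> K * P ^ n" and D': "\<bar>D'\<bar> \<le> K * P' ^ n"
    and diff: "\<bar>D - D'\<bar> \<le> L * \<epsilon> * P ^ (n - 1)" and PP: "P - P' \<le> G * \<epsilon>"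
    and g: "\<bar>g D - g D'\<bar> \<le> \<bar>D - D'\<bar> * (\<bar>D\<bar> + \<bar>D'\<bar>)" "\<bar>g D'\<bar> = D'\<^sup>2"
  shows "\<bar>g D / P ^ (2 * n - 1) - g D' / P' ^ (2 * n - 1)\<bar> \<le> (2 * K * L + (2 * real n - 1) * G * K\<^sup>2) * \<epsilon>"
proof (cases "P = 0")
  case True
  then have "P' = 0" using P by simp
  moreover obtain k where "2 * n - 1 = Suc k" using n by (cases "2 * n - 1") auto
  moreover have "0 \<le> (2 * K * L + (2 * real n - 1) * G * K\<^sup>2) * \<epsilon>"
    using n \<epsilon> LG K by (intro mult_nonneg_nonneg add_nonneg_nonneg) auto
  ultimately show ?thesis unfolding True by simp
next
  case False
  define m where "m = 2 * n - 1"
  have pos: "P > 0" using False P by simp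
  have Pm: "P ^ m = P ^ (n - 1) * P ^ n"
    using n by (simp add: m_def mult_2 flip: power_add)
  have PK: "\<bar>D'\<bar> \<le> K * P ^ n"
    using D' power_mono[OF P(2,1), of n] K by (meson mult_left_mono order_trans)
  have "\<bar>g D - g D'\<bar> \<le> (L * \<epsilon> * P ^ (n - 1)) * (2 * (K * P ^ n))"
    using g(1) diff D PK by (smt (verit) mult_mono abs_ge_zero)
  also have "\<dots> = 2 * K * L * \<epsilon> * P ^ m" by (simp add: Pm)
  finally have num: "\<bar>(g D - g D') / P ^ m\<bar> \<le> 2 * K * L * \<epsilon>"
    using pos by (simp add: field_simps)
  have denom: "\<bar>g D' / P ^ m - g D' / P' ^ m\<bar> \<le> m * G * K\<^sup>2 * \<epsilon>"
  proof (cases "P' = 0")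
    case True
    moreover have "0 < n" using n by simp
    ultimately have "g D' = 0" using D' g(2) by (simp add: zero_power[OF \<open>0 < n\<close>])
    then show ?thesis using LG \<epsilon> by simp
  next
    case False
    then have pos': "P' > 0" using P by simp
    define x where "x = P' / P"
    have x: "0 \<le> x" "x \<le> 1" using P pos by (auto simp: x_def)
    have "D'\<^sup>2 \<le> (K * P' ^ n)\<^sup>2" using D' by (metis abs_le_square_iff abs_of_nonneg abs_ge_zero order_trans power2_abs)
    also have "\<dots> = K\<^sup>2 * P' * P' ^ m"
      using n by (simp add: m_def power_mult_distrib flip: power_mult power_Suc) (simp add: mult.commute flip: power_Suc)
    finally have D'_sq: "\<bar>g D'\<bar> / P' ^ m \<le> K\<^sup>2 * P'" using pos' g(2) by (simp add: field_simps)
    have bern: "1 - x ^ m \<le> m * (1 - x)"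
      using Bernoulli_inequality[of "x - 1" m] x by (simp add: algebra_simps)
    have "x ^ m \<le> 1" using x by (simp add: power_le_one)
    have "g D' / P ^ m - g D' / P' ^ m = - (g D' / P' ^ m * (1 - x ^ m))"
      using pos pos' by (simp add: x_def power_divide field_simps)
    then have "\<bar>g D' / P ^ m - g D' / P' ^ m\<bar> = \<bar>g D'\<bar> / P' ^ m * (1 - x ^ m)"
      using pos' \<open>x ^ m \<le> 1\<close> by (simp add: abs_mult)
    also have "\<dots> \<le> (K\<^sup>2 * P') * (m * (1 - x))"
      using D'_sq bern pos' \<open>x ^ m \<le> 1\<close> by (intro mult_mono) auto
    also have "\<dots> = K\<^sup>2 * m * (x * (P - P'))" using pos by (simp add: x_def field_simps)
    also have "\<dots> \<le> K\<^sup>2 * m * (1 * (G * \<epsilon>))"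
      using x P PP by (intro mult_left_mono mult_mono) auto
    finally show ?thesis by (simp add: mult_ac)
  qed
  have "g D / P ^ m - g D' / P' ^ m = (g D - g D') / P ^ m + (g D' / P ^ m - g D' / P' ^ m)"
    by (simp add: diff_divide_distrib)
  then have "\<bar>g D / P ^ m - g D' / P' ^ m\<bar> \<le> 2 * K * L * \<epsilon> + m * G * K\<^sup>2 * \<epsilon>"
    using num denom by linarith
  then show ?thesis using n by (simp add: m_def algebra_simps of_nat_diff)
qed

text \<open>
  The constant of \<open>quotient_perturbation\<close> for simplices whose determinant is at most \<open>K * P ^ n\<close>,
  divided by the factor \<open>(n!)\<^sup>2\<close> that turns squared determinants into squared volumes.
\<close>

definition lipschitz_factor :: "nat \<Rightarrow> real \<Rightarrow> real" where
  "lipschitz_factor n K =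
     (2 * K * (2 * real n * (2 / real n) ^ (n - 1)) + (2 * real n - 1) * (real n * (real n + 1) / 2) * K\<^sup>2) / (fact n)\<^sup>2"

text \<open>
  Up to the factor \<open>(n!)\<^sup>2\<close> the strength is \<open>D\<^sup>2 / P ^ (2 * n - 1)\<close> and the signed strength is
  \<open>D * \<bar>D\<bar> / P ^ (2 * n - 1)\<close>. Both numerators \<open>g D\<close> satisfy
  \<open>\<bar>g x - g y\<bar> \<le> \<bar>x - y\<bar> * (\<bar>x\<bar> + \<bar>y\<bar>)\<close>, so a change of orientation needs no separate treatment.
  By symmetry \<open>q\<close> may be taken to have the smaller half-perimeter.
\<close>

lemma strengths_lipschitz:
  assumes n: "n \<ge> 1" and K: "0 \<le> K"
    and det_bound: "\<And>r. simplex_points n r \<Longrightarrow> \<bar>simplex_det n r\<bar> \<le> K * half_perimeter n r ^ n"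
    and p: "simplex_points n p" and q: "simplex_points n q"
    and close: "\<And>i. i \<le> n \<Longrightarrow> vnorm (p i - q i) \<le> \<epsilon>"
  shows "\<bar>strength n p - strength n q\<bar> \<le> lipschitz_factor n K * \<epsilon>
    \<and> \<bar>signed_strength n p - signed_strength n q\<bar> \<le> lipschitz_factor n K * \<epsilon>"
  using p q close
proof (induction "half_perimeter n q" "half_perimeter n p" arbitrary: p q rule: linorder_wlog)
  case (le p q)
  have \<epsilon>: "0 \<le> \<epsilon>" using le(4)[of 0] vnorm_nonneg order_trans by blast
  have nonneg: "0 \<le> half_perimeter n q" by (simp add: half_perimeter_def sum_nonneg)
  have D: "\<bar>simplex_det n p - simplex_det n q\<bar>
      \<le> (2 * real n * (2 / real n) ^ (n - 1)) * \<epsilon> * half_perimeter n p ^ (n - 1)"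
    by (rule simplex_det_perturbation[OF le(2,3) n _ le(1)]) (rule le(4))
  have P: "half_perimeter n p - half_perimeter n q \<le> real n * (real n + 1) / 2 * \<epsilon>"
    by (rule half_perimeter_perturbation[OF le(2,3)]) (rule le(4))
  note bound = quotient_perturbation[OF n nonneg le(1) \<epsilon> _ _ K det_bound[OF le(2)] det_bound[OF le(3)] D P]
  let ?f = "(fact n)\<^sup>2 :: real"
  have "\<bar>x\<^sup>2 - y\<^sup>2\<bar> \<le> \<bar>x - y\<bar> * (\<bar>x\<bar> + \<bar>y\<bar>)" for x y :: real
  proof -
    have "\<bar>x\<^sup>2 - y\<^sup>2\<bar> = \<bar>x - y\<bar> * \<bar>x + y\<bar>" by (simp add: power2_eq_square algebra_simps flip: abs_mult)
    also have "\<dots> \<le> \<bar>x - y\<bar> * (\<bar>x\<bar> + \<bar>y\<bar>)" by (intro mult_left_mono) auto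
    finally show ?thesis .
  qed
  note square = bound[of "\<lambda>x. x\<^sup>2", OF _ _ this]
  have "\<bar>x * \<bar>x\<bar> - y * \<bar>y\<bar>\<bar> \<le> \<bar>x - y\<bar> * (\<bar>x\<bar> + \<bar>y\<bar>)" for x y :: real
  proof -
    have "2 * (x * \<bar>x\<bar> - y * \<bar>y\<bar>) = (x - y) * (\<bar>x\<bar> + \<bar>y\<bar>) + (x + y) * (\<bar>x\<bar> - \<bar>y\<bar>)"
      by (simp add: algebra_simps)
    then have "2 * \<bar>x * \<bar>x\<bar> - y * \<bar>y\<bar>\<bar> \<le> \<bar>x - y\<bar> * (\<bar>x\<bar> + \<bar>y\<bar>) + \<bar>x + y\<bar> * \<bar>\<bar>x\<bar> - \<bar>y\<bar>\<bar>"
      using abs_triangle_ineq[of "(x - y) * (\<bar>x\<bar> + \<bar>y\<bar>)" "(x + y) * (\<bar>x\<bar> - \<bar>y\<bar>)"]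
        abs_mult[of 2 "x * \<bar>x\<bar> - y * \<bar>y\<bar>"] abs_of_nonneg[of "\<bar>x\<bar> + \<bar>y\<bar>"]
      by (simp only: abs_mult abs_numeral abs_ge_zero add_nonneg_nonneg)
    also have "\<bar>x + y\<bar> * \<bar>\<bar>x\<bar> - \<bar>y\<bar>\<bar> \<le> (\<bar>x\<bar> + \<bar>y\<bar>) * \<bar>x - y\<bar>"
      by (intro mult_mono) auto
    finally show ?thesis by (simp add: mult.commute)
  qed
  note signed = bound[of "\<lambda>x. x * \<bar>x\<bar>", OF _ _ this]
  have scale: "\<bar>a / ?f / b - c / ?f / d\<bar> \<le> X / ?f * \<epsilon>" if "\<bar>a / b - c / d\<bar> \<le> X * \<epsilon>" for a b c d X :: real
  proof -
    have "a / ?f / b - c / ?f / d = (a / b - c / d) / ?f" by (simp add: diff_divide_distrib mult.commute)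
    then show ?thesis using that by (simp add: abs_divide divide_right_mono)
  qed
  show ?case
    using scale[OF square] scale[OF signed]
    by (simp add: strength_eq[OF n le(2)] strength_eq[OF n le(3)] signed_strength_eq[OF n le(2)]
        signed_strength_eq[OF n le(3)] lipschitz_factor_def abs_mult power2_eq_square)
next
  case (sym p q)
  have "vnorm (q i - p i) \<le> \<epsilon>" if "i \<le> n" for i
    using sym(4)[OF that] vnorm_diff_commute[of "q i" n "p i"] sym(2,3) that by (simp add: simplex_points_def)
  then show ?case using sym by (simp add: abs_minus_commute)
qed

text \<open>
  In dimension \<open>1\<close> the signed strength is twice the signed length. The general estimate would give
  \<open>12\<close> instead of \<open>4\<close>.
\<close>

lemma segment_strengths_lipschitz:
  assumes p: "simplex_points 1 p" and q: "simplex_points 1 q"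
    and close: "\<And>i. i \<le> 1 \<Longrightarrow> vnorm (p i - q i) \<le> \<epsilon>"
  shows "\<bar>strength 1 p - strength 1 q\<bar> \<le> 4 * \<epsilon> \<and> \<bar>signed_strength 1 p - signed_strength 1 q\<bar> \<le> 4 * \<epsilon>"
proof -
  have eq: "strength 1 r = 2 * \<bar>simplex_det 1 r\<bar>" "signed_strength 1 r = 2 * simplex_det 1 r"
    "simplex_det 1 r = vec_index (r 1) 0 - vec_index (r 0) 0"
    if r: "simplex_points 1 r" for r
  proof -
    have c: "r 0 \<in> carrier_vec 1" using r by (simp add: simplex_points_def)
    show D: "simplex_det 1 r = vec_index (r 1) 0 - vec_index (r 0) 0"
      using edge_mat_index[OF r, of 0 0] by (simp add: det_single)
    have "half_perimeter 1 r = vnorm (r 0 - r 1) / 2"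
      by (simp add: half_perimeter_def)
    also have "vnorm (r 0 - r 1) = \<bar>simplex_det 1 r\<bar>"
      unfolding D using vnorm_diff_commute[OF c, of "r 1"] vnorm_diff[OF c, of "r 1"] r
      by (simp add: simplex_points_def lessThan_Suc)
    finally have P: "half_perimeter 1 r = \<bar>simplex_det 1 r\<bar> / 2" .
    show "strength 1 r = 2 * \<bar>simplex_det 1 r\<bar>"
      unfolding strength_eq[OF order_refl r] P by (simp add: power2_eq_square abs_if)
    show "signed_strength 1 r = 2 * simplex_det 1 r"
      unfolding signed_strength_eq[OF order_refl r] P by simp
  qed
  have "\<bar>vec_index (p i) 0 - vec_index (q i) 0\<bar> \<le> \<epsilon>" if "i \<le> 1" for i
    using close[OF that] vnorm_diff[of "q i" 1 "p i"] q that
    by (simp add: simplex_points_def lessThan_Suc)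
  from this[of 0] this[of 1]
  have "\<bar>vec_index (p 0) 0 - vec_index (q 0) 0\<bar> \<le> \<epsilon>" "\<bar>vec_index (p 1) 0 - vec_index (q 1) 0\<bar> \<le> \<epsilon>"
    by simp_all
  then have diff: "\<bar>simplex_det 1 p - simplex_det 1 q\<bar> \<le> 2 * \<epsilon>"
    unfolding eq(3)[OF p] eq(3)[OF q] by linarith
  then have "\<bar>\<bar>simplex_det 1 p\<bar> - \<bar>simplex_det 1 q\<bar>\<bar> \<le> 2 * \<epsilon>"
    using abs_triangle_ineq3 order_trans by blast
  moreover have "\<bar>2 * x - 2 * y\<bar> = 2 * \<bar>x - y\<bar>" for x y :: real by (simp add: abs_if)
  ultimately show ?thesis
    using diff unfolding eq(1,2)[OF p] eq(1,2)[OF q] by simp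
qed

lemma three_exp2_le_four_fact: "n \<ge> 3 \<Longrightarrow> 3 * 2 ^ n \<le> (4 * fact n :: real)"
proof (induction n rule: dec_induct)
  case base
  then show ?case by (simp add: numeral_3_eq_3)
next
  case (step n)
  have "3 * 2 ^ Suc n \<le> 2 * (4 * fact n :: real)" using step by simp
  also have "\<dots> \<le> (real n + 1) * (4 * fact n)" using step by (intro mult_right_mono) auto
  finally show ?case by (simp add: algebra_simps)
qed

text \<open>
  Division of the left side by the right side leaves a cubic polynomial in \<open>n\<close> times \<open>2 ^ n / n!\<close> over
  \<open>n ^ 4\<close>. As \<open>2 ^ n / n! \<le> 4/3\<close>, this is at most \<open>1\<close>.
\<close>

lemma lipschitz_factor_bound:
  assumes n: "n \<ge> 3"
  shows "lipschitz_factor n ((2 / n) ^ n) / 2 \<le> 2 ^ n / (fact n * real n ^ (2 * n - 4))"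
proof -
  define x where "x = real n"
  have x: "x \<ge> 3" using n by (simp add: x_def)
  have pow: "(2 / x) ^ n * (2 * x * (2 / x) ^ (n - 1)) = x\<^sup>2 * (2 ^ n * 2 ^ n / (x ^ n * x ^ n))"
  proof -
    have "(2 / x) ^ n = 2 / x * (2 / x) ^ (n - 1)" using n by (simp flip: power_Suc)
    then have "2 * x * (2 / x) ^ (n - 1) = x\<^sup>2 * (2 / x) ^ n" using x by (simp add: power2_eq_square)
    then show ?thesis by (simp add: power_divide)
  qed
  have split: "x ^ n * x ^ n = x ^ 4 * x ^ (2 * n - 4)"
  proof -
    have "n + n = 4 + (2 * n - 4)" using n by linarith
    then show ?thesis by (simp only: power_add[symmetric])
  qed
  let ?B = "2 ^ n / (fact n * x ^ (2 * n - 4))"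
  define q where "q = 2 ^ n * 2 ^ n / (x ^ n * x ^ n)"
  have sq: "((2 / x) ^ n)\<^sup>2 = q" by (simp add: q_def power2_eq_square power_divide)
  have "lipschitz_factor n ((2 / x) ^ n)
      = (2 * ((2 / x) ^ n * (2 * x * (2 / x) ^ (n - 1))) + (2 * x - 1) * (x * (x + 1) / 2) * ((2 / x) ^ n)\<^sup>2) / (fact n)\<^sup>2"
    unfolding lipschitz_factor_def x_def by (simp only: mult.assoc)
  also have "\<dots> = (2 * (x\<^sup>2 * q) + (2 * x - 1) * (x * (x + 1) / 2) * q) / (fact n)\<^sup>2"
    unfolding pow sq by (simp only: q_def)
  finally have "lipschitz_factor n ((2 / x) ^ n) / 2 = (x\<^sup>2 + (2 * x - 1) * x * (x + 1) / 4) * q / (fact n)\<^sup>2"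
    by (simp add: field_simps)
  also have "\<dots> = ?B * ((x\<^sup>2 + (2 * x - 1) * x * (x + 1) / 4) * (2 ^ n / fact n) / x ^ 4)"
    by (simp add: q_def split power2_eq_square[of "fact n"] mult_ac)
  also have "\<dots> \<le> ?B * 1"
  proof (rule mult_left_mono)
    have "2 ^ n / fact n \<le> (4 / 3 :: real)" using three_exp2_le_four_fact[OF n] by (simp add: field_simps)
    then have "(x\<^sup>2 + (2 * x - 1) * x * (x + 1) / 4) * (2 ^ n / fact n) \<le> (x\<^sup>2 + (2 * x - 1) * x * (x + 1) / 4) * (4 / 3)"
      using x by (intro mult_left_mono) auto
    also have "\<dots> \<le> x ^ 4"
    proof -
      define a b c where "a = x * x" and "b = x * a" and "c = x * b"
      have "a \<ge> 3 * x" using x by (auto simp: a_def intro!: mult_right_mono)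
      moreover have "b \<ge> 3 * a" using x by (auto simp: a_def b_def intro!: mult_right_mono)
      moreover have "c \<ge> 3 * b" using x by (auto simp: a_def b_def c_def intro!: mult_right_mono)
      moreover have fourth: "x ^ 4 = c" by (simp add: a_def b_def c_def power4_eq_xxxx)
      moreover have sum: "x\<^sup>2 + (2 * x - 1) * x * (x + 1) / 4 = 5 / 4 * a + b / 2 - x / 4"
        by (simp add: a_def b_def power2_eq_square field_simps)
      ultimately show ?thesis unfolding fourth sum using x by (simp add: field_simps)
    qed
    finally show "(x\<^sup>2 + (2 * x - 1) * x * (x + 1) / 4) * (2 ^ n / fact n) / x ^ 4 \<le> 1"
      using x by (simp add: divide_le_eq mult.commute[of "fact n"])
  qed (use x in simp)
  finally show ?thesis by (simp add: x_def)
qed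

definition lipschitz_constant :: "nat \<Rightarrow> real" where
  "lipschitz_constant n =
     (if n = 1 then 2 else if n = 2 then sqrt 3 else lipschitz_factor n ((2 / n) ^ n) / 2)"

text \<open>
  The three cases differ in the bound on the determinant: segments are computed directly, triangles use
  \<open>4/9 * P\<^sup>2\<close>, and from dimension \<open>3\<close> on Hadamard's \<open>(2 / n) ^ n * P ^ n\<close> suffices.
\<close>

lemma strengths_lipschitz_constant:
  assumes n: "n \<ge> 1" and \<epsilon>: "\<epsilon> > 0" and p: "simplex_points n p" and q: "simplex_points n q"
    and close: "\<And>i. i \<le> n \<Longrightarrow> vnorm (p i - q i) \<le> \<epsilon>"
  shows "\<bar>strength n p - strength n q\<bar> \<le> 2 * lipschitz_constant n * \<epsilon>
    \<and> \<bar>signed_strength n p - signed_strength n q\<bar> \<le> 2 * lipschitz_constant n * \<epsilon>"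
proof -
  consider "n = 1" | "n = 2" | "n \<ge> 3" using n by linarith
  then show ?thesis
  proof cases
    case 1
    then show ?thesis using segment_strengths_lipschitz[of p q \<epsilon>] p q close by (simp add: lipschitz_constant_def)
  next
    case 2
    have "(4/3)\<^sup>2 \<le> (3 :: real)" by (simp add: power2_eq_square)
    then have "4/3 \<le> sqrt 3" by (rule real_le_rsqrt)
    moreover have "lipschitz_factor 2 (4/9) = 4/3" by (simp add: lipschitz_factor_def power2_eq_square)
    ultimately have "lipschitz_factor 2 (4/9) * \<epsilon> \<le> 2 * lipschitz_constant 2 * \<epsilon>"
      using \<epsilon> by (intro mult_right_mono) (auto simp: lipschitz_constant_def)
    then show ?thesis
      using strengths_lipschitz[of 2 "4/9" p q \<epsilon>] triangle_det_bound p q close 2 by fastforce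
  next
    case 3
    then show ?thesis
      using strengths_lipschitz[OF n, of "(2 / n) ^ n" p q \<epsilon>] simplex_det_bound[OF _ n] p q close
      by (simp add: lipschitz_constant_def)
  qed
qed

lemma lipschitz_constant_pos:
  assumes "n \<ge> 1"
  shows "lipschitz_constant n > 0"
proof -
  have "lipschitz_factor n ((2 / n) ^ n) > 0"
    using assms unfolding lipschitz_factor_def
    by (intro divide_pos_pos add_pos_nonneg mult_pos_pos mult_nonneg_nonneg) auto
  then show ?thesis by (simp add: lipschitz_constant_def)
qed

lemma lipschitz_constant_bound:
  assumes "n \<ge> 3"
  shows "lipschitz_constant n \<le> 2 powr (real n + 1/2) / (fact n * real n ^ (2 * n - 4))"
proof -
  have "lipschitz_constant n \<le> 2 ^ n / (fact n * real n ^ (2 * n - 4))"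
    using lipschitz_factor_bound[OF assms] assms by (simp add: lipschitz_constant_def)
  also have "2 ^ n \<le> (2 :: real) powr (real n + 1/2)"
    by (simp add: powr_realpow[symmetric])
  finally show ?thesis by (simp add: divide_right_mono)
qed

lemma lipschitz_constant_3: "lipschitz_constant 3 < 37/100"
  using lipschitz_factor_bound[of 3] by (simp add: lipschitz_constant_def fact_numeral)

section \<open>Structured programs with time bounds\<close>

text \<open>
  An abstract view of the memory: the input region is a matrix \<open>M\<close> with \<open>n + 1\<close> rows of length \<open>n\<close>, and
  the cells after it hold scalars \<open>S 0, S 1, \<dots>\<close> of the program. Register \<open>0\<close> keeps the dimension.
\<close>

definition represents :: "nat \<Rightarrow> (nat \<Rightarrow> nat) \<Rightarrow> (nat \<Rightarrow> nat \<Rightarrow> real) \<Rightarrow> (nat \<Rightarrow> real) \<Rightarrow> ram_state \<Rightarrow> bool" where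
  "represents n \<rho> M S s \<longleftrightarrow> \<rho> 0 = n \<and> fst s = \<rho> \<and>
     (\<forall>i\<le>n. \<forall>k<n. snd s (i * n + k) = M i k) \<and> (\<forall>c. snd s ((n + 1) * n + c) = S c)"

text \<open>
  Total correctness with a time bound. The registers are the same before and after, so loop counters
  have to be restored; this lets loops nest without a description of their leftovers.
\<close>

definition transforms :: "nat \<Rightarrow> (nat \<Rightarrow> nat) \<Rightarrow> prog \<Rightarrow> nat \<Rightarrow>
    (nat \<Rightarrow> nat \<Rightarrow> real) \<Rightarrow> (nat \<Rightarrow> real) \<Rightarrow> (nat \<Rightarrow> nat \<Rightarrow> real) \<Rightarrow> (nat \<Rightarrow> real) \<Rightarrow> bool" where
  "transforms n \<rho> c T M S M' S' \<longleftrightarrow> (\<forall>s. represents n \<rho> M S s \<longrightarrow>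
     (\<exists>t s'. runs c s t s' \<and> t \<le> T \<and> represents n \<rho> M' S' s'))"

definition cell :: "iexp \<Rightarrow> iexp \<Rightarrow> iexp" where
  "cell i k = IAdd (IMul i (IReg 0)) k"

definition scal :: "nat \<Rightarrow> iexp" where
  "scal c = IAdd (IMul (IAdd (IReg 0) (INat 1)) (IReg 0)) (INat c)"

lemma icost_cell [simp]: "icost (cell i k) = icost i + icost k + 3"
  by (simp add: cell_def)

lemma icost_scal [simp]: "icost (scal c) = 7"
  by (simp add: scal_def)

lemma cell_address_less:
  assumes "i \<le> n" "k < (n::nat)"
  shows "i * n + k < (n + 1) * n"
  using mult_le_mono1[OF assms(1), of n] assms(2) unfolding add_mult_distrib by linarith

lemma cell_address_inj:
  assumes "k < n" "k' < (n::nat)"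
  shows "i * n + k = i' * n + k' \<longleftrightarrow> i = i' \<and> k = k'"
proof
  assume eq: "i * n + k = i' * n + k'"
  have less: "a * n + b < c * n + d" if "a < c" "b < n" for a b c d
    using mult_le_mono1[of "Suc a" c n] that unfolding mult_Suc by linarith
  have "\<not> i < i'" using less[of i i' k k'] eq assms(1) by linarith
  moreover have "\<not> i' < i" using less[of i' i k' k] eq assms(2) by linarith
  ultimately have "i = i'" by linarith
  then show "i = i' \<and> k = k'" using eq by simp
qed simp

lemma representsD:
  assumes "represents n \<rho> M S s"
  shows "\<rho> 0 = n" "fst s = \<rho>" "\<And>i k. i \<le> n \<Longrightarrow> k < n \<Longrightarrow> snd s (i * n + k) = M i k"
    "\<And>c. snd s ((n + 1) * n + c) = S c"
  using assms unfolding represents_def by blast+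

lemma representsI:
  assumes "\<rho> 0 = n" "fst s = \<rho>" "\<And>i k. i \<le> n \<Longrightarrow> k < n \<Longrightarrow> snd s (i * n + k) = M i k"
    "\<And>c. snd s ((n + 1) * n + c) = S c"
  shows "represents n \<rho> M S s"
  using assms unfolding represents_def by blast

lemmas represents_fst [simp] = representsD(2)

lemma rval_scal:
  assumes "represents n \<rho> M S s"
  shows "rval (RMem (scal c)) s = S c"
  by (simp only: rval.simps scal_def ival.simps representsD[OF assms])

lemma rval_cell:
  assumes "represents n \<rho> M S s" "ival i s \<le> n" "ival k s < n"
  shows "rval (RMem (cell i k)) s = M (ival i s) (ival k s)"
  by (simp only: rval.simps cell_def ival.simps representsD(1,2)[OF assms(1)] representsD(3)[OF assms])

lemma represents_cong:
  assumes "\<And>i k. i \<le> n \<Longrightarrow> k < n \<Longrightarrow> M i k = M' i k"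
  shows "represents n \<rho> M S s = represents n \<rho> M' S s"
  using assms unfolding represents_def by metis

lemma transforms_weaken:
  assumes "transforms n \<rho> c T M S M' S'" "T \<le> T'"
    and "\<And>i k. i \<le> n \<Longrightarrow> k < n \<Longrightarrow> M' i k = M'' i k" "S' = S''"
  shows "transforms n \<rho> c T' M S M'' S''"
  using assms represents_cong[of n M' M'' \<rho> S'] unfolding transforms_def by (metis order_trans)

lemma transforms_Seq:
  assumes "transforms n \<rho> c T M S M' S'" "transforms n \<rho> d U M' S' M'' S''"
  shows "transforms n \<rho> (Seq c d) (T + U) M S M'' S''"
  using assms unfolding transforms_def by (meson add_mono run_Seq)

lemma transforms_Cond:
  assumes "\<And>s. represents n \<rho> M S s \<Longrightarrow> bval b s \<longleftrightarrow> B"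
    and "B \<Longrightarrow> transforms n \<rho> c T M S M' S'" "\<not> B \<Longrightarrow> transforms n \<rho> d T M S M' S'"
  shows "transforms n \<rho> (Cond b c d) (1 + bcost b + T) M S M' S'"
  unfolding transforms_def
proof (intro allI impI)
  fix s assume s: "represents n \<rho> M S s"
  show "\<exists>t s'. runs (Cond b c d) s t s' \<and> t \<le> 1 + bcost b + T \<and> represents n \<rho> M' S' s'"
  proof (cases B)
    case True
    then obtain t s' where "runs c s t s'" "t \<le> T" "represents n \<rho> M' S' s'"
      using assms(2) s unfolding transforms_def by blast
    then show ?thesis using run_CondTrue[of b s c t s' d] assms(1)[OF s] True by fastforce
  next
    case False
    then obtain t s' where "runs d s t s'" "t \<le> T" "represents n \<rho> M' S' s'"
      using assms(3) s unfolding transforms_def by blast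
    then show ?thesis using run_CondFalse[of b s d t s' c] assms(1)[OF s] False by fastforce
  qed
qed

lemma transforms_set_cell:
  assumes "\<And>s. represents n \<rho> M S s \<Longrightarrow> ival i s = a \<and> ival k s = b \<and> rval x s = v" "a \<le> n" "b < n"
  shows "transforms n \<rho> (SetMem (cell i k) x) (icost i + icost k + rcost x + 4) M S (M(a := (M a)(b := v))) S"
  unfolding transforms_def
proof (intro allI impI)
  fix s assume s: "represents n \<rho> M S s"
  have addr: "ival (cell i k) s = a * n + b"
    using assms(1)[OF s] by (simp only: cell_def ival.simps representsD(1,2)[OF s])
  let ?s = "(fst s, (snd s)(ival (cell i k) s := rval x s))"
  have "represents n \<rho> (M(a := (M a)(b := v))) S ?s"
  proof (rule representsI)
    show "snd ?s (j * n + l) = (M(a := (M a)(b := v))) j l" if "j \<le> n" "l < n" for j l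
    proof (cases "j = a \<and> l = b")
      case True
      then show ?thesis using assms(1)[OF s] by (simp only: snd_conv addr fun_upd_same)
    next
      case False
      then have "j * n + l \<noteq> a * n + b" using cell_address_inj[OF that(2) assms(3)] by blast
      moreover have "(M(a := (M a)(b := v))) j l = M j l" using False by auto
      ultimately show ?thesis using representsD(3)[OF s that] by (simp only: snd_conv addr fun_upd_other not_False_eq_True)
    qed
    show "snd ?s ((n + 1) * n + c) = S c" for c
    proof -
      have "(n + 1) * n + c \<noteq> a * n + b" using cell_address_less[OF assms(2,3)] by linarith
      then show ?thesis using representsD(4)[OF s] by (simp only: snd_conv addr fun_upd_other not_False_eq_True)
    qed
  qed (simp_all only: representsD(1,2)[OF s] fst_conv)
  then show "\<exists>t s'. runs (SetMem (cell i k) x) s t s' \<and> t \<le> icost i + icost k + rcost x + 4 \<and>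
      represents n \<rho> (M(a := (M a)(b := v))) S s'"
    using run_SetMem[of "cell i k" x s] by (intro exI conjI) (assumption | simp)+
qed

lemma transforms_set_scal:
  assumes "\<And>s. represents n \<rho> M S s \<Longrightarrow> rval x s = v"
  shows "transforms n \<rho> (SetMem (scal c) x) (rcost x + 8) M S M (S(c := v))"
  unfolding transforms_def
proof (intro allI impI)
  fix s assume s: "represents n \<rho> M S s"
  have addr: "ival (scal c) s = (n + 1) * n + c"
    by (simp only: scal_def ival.simps representsD(1,2)[OF s])
  let ?s = "(fst s, (snd s)(ival (scal c) s := rval x s))"
  have "represents n \<rho> M (S(c := v)) ?s"
  proof (rule representsI)
    show "snd ?s (i * n + k) = M i k" if "i \<le> n" "k < n" for i k
    proof -
      have "i * n + k \<noteq> (n + 1) * n + c" using cell_address_less[OF that] by linarith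
      then show ?thesis using representsD(3)[OF s that] by (simp only: snd_conv addr fun_upd_other not_False_eq_True)
    qed
    show "snd ?s ((n + 1) * n + d) = (S(c := v)) d" for d
      using representsD(4)[OF s, of d] assms[OF s]
      by (cases "d = c") (simp_all only: snd_conv addr fun_upd_apply add_left_cancel if_True if_False simp_thms)
  qed (simp_all only: representsD(1,2)[OF s] fst_conv)
  then show "\<exists>t s'. runs (SetMem (scal c) x) s t s' \<and> t \<le> rcost x + 8 \<and> represents n \<rho> M (S(c := v)) s'"
    using run_SetMem[of "scal c" x s] by (intro exI conjI) (assumption | simp)+
qed

text \<open>
  The counter is reset to \<open>0\<close> at the end, which restores its value before the loop.
\<close>

definition for_loop :: "nat \<Rightarrow> iexp \<Rightarrow> iexp \<Rightarrow> prog \<Rightarrow> prog" where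
  "for_loop r lo hi body = Seq (SetReg r lo) (Seq
     (Loop (BILess (IReg r) hi) (Seq body (SetReg r (IAdd (IReg r) (INat 1)))))
     (SetReg r (INat 0)))"

lemma represents_set_reg:
  assumes "represents n \<rho> M S s" "r \<noteq> 0"
  shows "represents n (\<rho>(r := v)) M S ((fst s)(r := v), snd s)"
  using assms representsD[OF assms(1)] by (intro representsI) auto

text \<open>
  The families \<open>M\<close> and \<open>S\<close> describe the memory before each round. All loops used here make at most
  \<open>n + 1\<close> rounds; \<open>B\<close> bounds a round including its bookkeeping, and as there is a factor \<open>n + 1 \<ge> 1\<close>
  it also absorbs the cost of entering and leaving the loop.
\<close>

lemma transforms_for_loop:
  assumes r: "r \<noteq> 0" "\<rho> r = 0"
    and lo: "\<And>m. ival lo (\<rho>, m) = L" and hi: "\<And>i m. ival hi (\<rho>(r := i), m) = N"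
    and body: "\<And>i. L \<le> i \<Longrightarrow> i < N \<Longrightarrow> transforms n (\<rho>(r := i)) body T (M i) (S i) (M (Suc i)) (S (Suc i))"
    and LN: "L \<le> N" "N \<le> n + 1" and B: "T + 2 * icost hi + icost lo + 13 \<le> B"
  shows "transforms n \<rho> (for_loop r lo hi body) ((n + 1) * B) (M L) (S L) (M N) (S N)"
proof -
  let ?b = "BILess (IReg r) hi" and ?c = "Seq body (SetReg r (IAdd (IReg r) (INat 1)))"
  let ?h = "icost hi"
  have hi': "ival hi s = N" if "represents n (\<rho>(r := i)) M' S' s" for i M' S' s
    using hi[of i "snd s"] represents_fst[OF that] by (metis prod.collapse)
  have loop: "\<exists>t s'. runs (Loop ?b ?c) s t s' \<and> t \<le> (N - i) * (T + ?h + 7) + ?h + 3 \<and>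
      represents n (\<rho>(r := N)) (M N) (S N) s'"
    if "i \<le> N" "L \<le> i" "represents n (\<rho>(r := i)) (M i) (S i) s" for i s
    using that
  proof (induction i arbitrary: s rule: inc_induct)
    case base
    then have "\<not> bval ?b s" using hi'[OF base(2)] represents_fst[OF base(2)] by simp
    then show ?case using run_LoopFalse[of ?b s ?c] base by (intro exI conjI) (assumption | simp)+
  next
    case (step i)
    have b: "bval ?b s" using hi'[OF step.prems(2)] represents_fst[OF step.prems(2)] step.hyps by simp
    obtain t s1 where s1: "runs body s t s1" "t \<le> T" "represents n (\<rho>(r := i)) (M (Suc i)) (S (Suc i)) s1"
      using body[of i] step unfolding transforms_def by blast
    let ?s2 = "((fst s1)(r := ival (IAdd (IReg r) (INat 1)) s1), snd s1)"
    have "t + (1 + icost (IAdd (IReg r) (INat 1))) = t + 4" by simp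
    then have s2: "runs ?c s (t + 4) ?s2"
      using run_Seq[OF s1(1) run_SetReg[of r "IAdd (IReg r) (INat 1)" s1]] by (simp only:)
    have rep: "represents n (\<rho>(r := Suc i)) (M (Suc i)) (S (Suc i)) ?s2"
      using represents_set_reg[OF s1(3) r(1), of "Suc i"] represents_fst[OF s1(3)] by simp
    have "L \<le> Suc i" using step.prems by simp
    from step.IH[OF this rep] obtain u s3 where s3: "runs (Loop ?b ?c) ?s2 u s3"
      "u \<le> (N - Suc i) * (T + ?h + 7) + ?h + 3" "represents n (\<rho>(r := N)) (M N) (S N) s3"
      by blast
    have "1 + bcost ?b + (t + 4) + u \<le> (T + ?h + 7) + ((N - Suc i) * (T + ?h + 7) + ?h + 3)"
      using s1(2) s3(2) by simp
    also have "\<dots> = (N - i) * (T + ?h + 7) + ?h + 3"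
      using step.hyps by (metis Suc_diff_Suc add.assoc mult_Suc)
    finally show ?case using run_LoopTrue[OF b s2 s3(1)] s3(3) by blast
  qed
  show ?thesis
    unfolding transforms_def
  proof (intro allI impI)
    fix s assume s: "represents n \<rho> (M L) (S L) s"
    have "ival lo s = L" using lo[of "snd s"] represents_fst[OF s] by (metis prod.collapse)
    then have s1: "runs (SetReg r lo) s (1 + icost lo) ((fst s)(r := L), snd s)"
      using run_SetReg[of r lo s] by simp
    from loop[OF LN(1) order_refl represents_set_reg[OF s r(1)]]
    obtain t s2 where s2: "runs (Loop ?b ?c) ((fst s)(r := L), snd s) t s2"
      "t \<le> (N - L) * (T + ?h + 7) + ?h + 3" "represents n (\<rho>(r := N)) (M N) (S N) s2" by blast
    have s3: "runs (SetReg r (INat 0)) s2 2 ((fst s2)(r := 0), snd s2)"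
      using run_SetReg[of r "INat 0" s2] by (simp add: numeral_2_eq_2)
    have "represents n \<rho> (M N) (S N) ((fst s2)(r := 0), snd s2)"
      using represents_set_reg[OF s2(3) r(1), of 0] r(2) by (simp add: fun_upd_idem)
    moreover have "runs (for_loop r lo hi body) s (1 + icost lo + (t + 2)) ((fst s2)(r := 0), snd s2)"
      unfolding for_loop_def by (rule run_Seq[OF s1 run_Seq[OF s2(1) s3]])
    moreover have "1 + icost lo + (t + 2) \<le> (n + 1) * B"
    proof -
      have "1 + icost lo + (t + 2) \<le> (N - L) * (T + ?h + 7) + (?h + icost lo + 6)"
        using s2(2) by simp
      also have "\<dots> \<le> (n + 1) * (T + ?h + 7) + (n + 1) * (?h + icost lo + 6)"
        using LN by (intro add_mono mult_le_mono) auto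
      also have "\<dots> = (n + 1) * (T + 2 * ?h + icost lo + 13)" by (simp add: algebra_simps)
      also have "\<dots> \<le> (n + 1) * B" using B by (rule mult_le_mono2)
      finally show ?thesis .
    qed
    ultimately show "\<exists>t s'. runs (for_loop r lo hi body) s t s' \<and> t \<le> (n + 1) * B \<and> represents n \<rho> (M N) (S N) s'"
      by blast
  qed
qed

definition row_add :: "(nat \<Rightarrow> nat \<Rightarrow> real) \<Rightarrow> nat \<Rightarrow> nat \<Rightarrow> real \<Rightarrow> nat \<Rightarrow> nat \<Rightarrow> real" where
  "row_add M a b x = M(a := (\<lambda>k. M a k + x * M b k))"

definition row_add_prog :: "iexp \<Rightarrow> iexp \<Rightarrow> nat \<Rightarrow> prog" where
  "row_add_prog i j c = for_loop 3 (INat 0) (IReg 0)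
     (SetMem (cell i (IReg 3))
        (RAdd (RMem (cell i (IReg 3))) (RMul (RMem (scal c)) (RMem (cell j (IReg 3))))))"

text \<open>
  With index expressions of cost at most \<open>3\<close> a round costs at most \<open>40\<close>, and the loop adds \<open>16\<close>. The
  numeric constants in the later time bounds are counted in the same way.
\<close>

lemma transforms_row_add_prog:
  assumes \<rho>: "\<rho> 0 = n" "\<rho> 3 = 0"
    and ij: "\<And>k m. ival i (\<rho>(3 := k), m) = a \<and> ival j (\<rho>(3 := k), m) = b" "a \<le> n" "b \<le> n" "a \<noteq> b"
    and cost: "icost i \<le> 3" "icost j \<le> 3"
  shows "transforms n \<rho> (row_add_prog i j c) ((n + 1) * 60) M S (row_add M a b (S c)) S"
proof -
  \<comment> \<open>The matrix after the first \<open>l\<close> columns.\<close>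
  define R where "R l = M(a := (\<lambda>k. if k < l then M a k + S c * M b k else M a k))" for l
  have "transforms n \<rho> (row_add_prog i j c) ((n + 1) * 60) (R 0) S (R n) S"
    unfolding row_add_prog_def
  proof (rule transforms_for_loop)
    fix l assume l: "l < n"
    have ij': "ival i s = a" "ival j s = b" if "represents n (\<rho>(3 := l)) (R l) S s" for s
      using ij(1)[of l "snd s"] represents_fst[OF that] by (metis prod.collapse)+
    have "transforms n (\<rho>(3 := l))
       (SetMem (cell i (IReg 3)) (RAdd (RMem (cell i (IReg 3))) (RMul (RMem (scal c)) (RMem (cell j (IReg 3))))))
       (icost i + icost (IReg 3) + rcost (RAdd (RMem (cell i (IReg 3))) (RMul (RMem (scal c)) (RMem (cell j (IReg 3))))) + 4)
       (R l) S ((R l)(a := (R l a)(l := R l a l + S c * R l b l))) S"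
      using ij(2,3) l by (intro transforms_set_cell) (auto simp: ij' rval_cell rval_scal simp del: rval.simps(2))
    then show "transforms n (\<rho>(3 := l))
       (SetMem (cell i (IReg 3)) (RAdd (RMem (cell i (IReg 3))) (RMul (RMem (scal c)) (RMem (cell j (IReg 3))))))
       40 (R l) S (R (Suc l)) S"
      by (rule transforms_weaken) (use ij(4) cost in \<open>auto simp: R_def less_Suc_eq\<close>)
  qed (use \<rho> in auto)
  moreover have "R 0 = M" by (auto simp: R_def)
  ultimately have "transforms n \<rho> (row_add_prog i j c) ((n + 1) * 60) M S (R n) S" by simp
  then show ?thesis by (rule transforms_weaken) (auto simp: R_def row_add_def)
qed

section \<open>Computing the strength in cubic time\<close>

declare rval.simps(2) [simp del] rval_cell [simp] rval_scal [simp]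

abbreviation coord_diff :: rexp where
  "coord_diff \<equiv> RSub (RMem (cell (IReg 2) (IReg 3))) (RMem (cell (IReg 1) (IReg 3)))"

definition distance_prog :: prog where
  "distance_prog = for_loop 3 (INat 0) (IReg 0) (SetMem (scal 1) (RAdd (RMem (scal 1))
     (RMul coord_diff coord_diff)))"

lemma transforms_distance_prog:
  assumes \<rho>: "\<rho> 0 = n" "\<rho> 1 = j" "\<rho> 2 = i" "\<rho> 3 = 0" and ij: "i \<le> n" "j \<le> n"
  shows "transforms n \<rho> distance_prog ((n + 1) * 60) M S M (S(1 := S 1 + (\<Sum>k<n. (M i k - M j k)\<^sup>2)))"
proof -
  define R where "R l = S(1 := S 1 + (\<Sum>k<l. (M i k - M j k)\<^sup>2))" for l
  have "transforms n \<rho> distance_prog ((n + 1) * 60) M (R 0) M (R n)"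
    unfolding distance_prog_def
  proof (rule transforms_for_loop)
    fix l assume l: "l < n"
    let ?e = "RAdd (RMem (scal 1))
     (RMul coord_diff coord_diff)"
    have "transforms n (\<rho>(3 := l)) (SetMem (scal 1) ?e) (rcost ?e + 8) M (R l) M ((R l)(1 := R l 1 + (M i l - M j l)\<^sup>2))"
      using \<rho> ij l by (intro transforms_set_scal) (simp add: power2_eq_square)
    then show "transforms n (\<rho>(3 := l)) (SetMem (scal 1) ?e) 44 M (R l) M (R (Suc l))"
      by (rule transforms_weaken) (auto simp: R_def)
  qed (use \<rho> in auto)
  moreover have "R 0 = S" by (simp add: R_def)
  ultimately show ?thesis by (simp add: R_def)
qed

text \<open>
  Scalar \<open>1\<close> collects a squared distance and scalar \<open>0\<close> the sum of the distances. Scalar \<open>1\<close> is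
  cleared after use so that it is \<open>0\<close> at the beginning of every round.
\<close>

definition perimeter_prog :: prog where
  "perimeter_prog = Seq
     (for_loop 1 (INat 0) (IAdd (IReg 0) (INat 1)) (for_loop 2 (INat 0) (IReg 1)
       (Seq distance_prog (Seq
         (SetMem (scal 0) (RAdd (RMem (scal 0)) (RSqrt (RMem (scal 1)))))
         (SetMem (scal 1) (RConst 0))))))
     (SetMem (scal 0) (RDiv (RMem (scal 0)) (RConst 2)))"

lemma transforms_perimeter_prog:
  fixes M :: "nat \<Rightarrow> nat \<Rightarrow> real"
  assumes \<rho>: "\<rho> 0 = n" "\<rho> 1 = 0" "\<rho> 2 = 0" "\<rho> 3 = 0"
  defines "d \<equiv> \<lambda>i j. sqrt (\<Sum>k<n. (M i k - M j k)\<^sup>2)"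
  shows "transforms n \<rho> perimeter_prog ((n + 1) * ((n + 1) * ((n + 1) * 140)) + 18) M (\<lambda>_. 0) M
     ((\<lambda>_. 0)(0 := (\<Sum>j\<le>n. \<Sum>i<j. d i j) / 2))"
proof -
  let ?pair = "Seq distance_prog (Seq (SetMem (scal 0) (RAdd (RMem (scal 0)) (RSqrt (RMem (scal 1)))))
         (SetMem (scal 1) (RConst 0)))"
  let ?Z = "\<lambda>x. (\<lambda>_::nat. 0 :: real)(0 := x)"
  have pair: "transforms n (\<rho>(1 := j, 2 := i)) ?pair ((n + 1) * 60 + (26 + 9)) M (?Z x) M (?Z (x + d i j))"
    if ij: "i \<le> n" "j \<le> n" for i j x
  proof -
    let ?s = "\<Sum>k<n. (M i k - M j k)\<^sup>2"
    have "transforms n (\<rho>(1 := j, 2 := i)) distance_prog ((n + 1) * 60) M (?Z x) M ((?Z x)(1 := ?Z x 1 + ?s))"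
      using transforms_distance_prog[of "\<rho>(1 := j, 2 := i)" n j i M "?Z x"] \<rho> ij by simp
    moreover have "transforms n (\<rho>(1 := j, 2 := i)) (SetMem (scal 0) (RAdd (RMem (scal 0)) (RSqrt (RMem (scal 1))))) 26
        M ((?Z x)(1 := ?Z x 1 + ?s)) M ((?Z x)(1 := ?Z x 1 + ?s, 0 := x + d i j))"
      by (rule transforms_weaken[OF transforms_set_scal[where v = "x + d i j"]]) (auto simp: d_def)
    moreover have "transforms n (\<rho>(1 := j, 2 := i)) (SetMem (scal 1) (RConst 0)) 9
        M ((?Z x)(1 := ?Z x 1 + ?s, 0 := x + d i j)) M (?Z (x + d i j))"
      by (rule transforms_weaken[OF transforms_set_scal[where v = 0]]) auto
    ultimately show ?thesis by (blast intro: transforms_Seq)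
  qed
  have inner: "transforms n (\<rho>(1 := j)) (for_loop 2 (INat 0) (IReg 1) ?pair) ((n + 1) * ((n + 1) * 120))
      M (?Z x) M (?Z (x + (\<Sum>i<j. d i j)))" if j: "j \<le> n" for j x
  proof -
    have "transforms n (\<rho>(1 := j)) (for_loop 2 (INat 0) (IReg 1) ?pair) ((n + 1) * ((n + 1) * 120))
      M (?Z (x + (\<Sum>i<0. d i j))) M (?Z (x + (\<Sum>i<j. d i j)))"
    proof (rule transforms_for_loop[where S = "\<lambda>l. ?Z (x + (\<Sum>i<l. d i j))" and M = "\<lambda>_. M"])
      fix i assume "i < j"
      then show "transforms n (\<rho>(1 := j, 2 := i)) ?pair ((n + 1) * 60 + (26 + 9))
          M (?Z (x + (\<Sum>i<i. d i j))) M (?Z (x + (\<Sum>i<Suc i. d i j)))"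
        using pair[of i j "x + (\<Sum>i<i. d i j)"] j by (simp add: add.assoc)
    qed (use \<rho> j in auto)
    then show ?thesis by simp
  qed
  have outer: "transforms n \<rho> (for_loop 1 (INat 0) (IAdd (IReg 0) (INat 1)) (for_loop 2 (INat 0) (IReg 1) ?pair))
      ((n + 1) * ((n + 1) * ((n + 1) * 140))) M (?Z (\<Sum>j<0. \<Sum>i<j. d i j)) M (?Z (\<Sum>j<n + 1. \<Sum>i<j. d i j))"
  proof (rule transforms_for_loop[where S = "\<lambda>l. ?Z (\<Sum>j<l. \<Sum>i<j. d i j)" and M = "\<lambda>_. M"])
    fix j assume "j < n + 1"
    then show "transforms n (\<rho>(1 := j)) (for_loop 2 (INat 0) (IReg 1) ?pair) ((n + 1) * ((n + 1) * 120))
        M (?Z (\<Sum>j<j. \<Sum>i<j. d i j)) M (?Z (\<Sum>j<Suc j. \<Sum>i<j. d i j))"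
      using inner[of j "\<Sum>j<j. \<Sum>i<j. d i j"] by simp
  qed (use \<rho> in \<open>auto simp: algebra_simps\<close>)
  have "transforms n \<rho> (SetMem (scal 0) (RDiv (RMem (scal 0)) (RConst 2))) 18
      M (?Z (\<Sum>j<n + 1. \<Sum>i<j. d i j)) M (?Z ((\<Sum>j\<le>n. \<Sum>i<j. d i j) / 2))"
    by (rule transforms_weaken[OF transforms_set_scal[where v = "(\<Sum>j\<le>n. \<Sum>i<j. d i j) / 2"]])
      (auto simp: lessThan_Suc_atMost)
  moreover have "?Z (\<Sum>j<0. \<Sum>i<j. d i j) = (\<lambda>_. 0)" by auto
  ultimately show ?thesis
    using transforms_Seq[OF outer] unfolding perimeter_prog_def by (simp only:)
qed

text \<open>
  Row \<open>0\<close> is subtracted from all other rows, which makes rows \<open>1, \<dots>, n\<close> the edge vectors at \<open>p 0\<close>.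
\<close>

definition subtract_prog :: prog where
  "subtract_prog = Seq (SetMem (scal 2) (RConst (-1)))
     (for_loop 2 (INat 1) (IAdd (IReg 0) (INat 1)) (row_add_prog (IReg 2) (INat 0) 2))"

lemma transforms_subtract_prog:
  assumes \<rho>: "\<rho> 0 = n" "\<rho> 2 = 0" "\<rho> 3 = 0"
  shows "transforms n \<rho> subtract_prog (9 + (n + 1) * ((n + 1) * 80)) M S
     (\<lambda>a k. if 1 \<le> a then M a k - M 0 k else M a k) (S(2 := -1))"
proof -
  define R where "R i = (\<lambda>a k. if 1 \<le> a \<and> a < i then M a k - M 0 k else M a k)" for i
  have "transforms n \<rho> (SetMem (scal 2) (RConst (-1))) 9 M S M (S(2 := -1))"
    by (rule transforms_weaken[OF transforms_set_scal[where v = "-1"]]) auto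
  moreover have "transforms n \<rho> (for_loop 2 (INat 1) (IAdd (IReg 0) (INat 1)) (row_add_prog (IReg 2) (INat 0) 2))
     ((n + 1) * ((n + 1) * 80)) (R 1) (S(2 := -1)) (R (n + 1)) (S(2 := -1))"
  proof (rule transforms_for_loop[where S = "\<lambda>_. S(2 := -1)" and M = R])
    fix i assume i: "1 \<le> i" "i < n + 1"
    have "transforms n (\<rho>(2 := i)) (row_add_prog (IReg 2) (INat 0) 2) ((n + 1) * 60) (R i) (S(2 := -1))
        (row_add (R i) i 0 ((S(2 := -1)) 2)) (S(2 := -1))"
      using \<rho> i by (intro transforms_row_add_prog) auto
    then show "transforms n (\<rho>(2 := i)) (row_add_prog (IReg 2) (INat 0) 2) ((n + 1) * 60) (R i) (S(2 := -1))
        (R (Suc i)) (S(2 := -1))"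
      by (rule transforms_weaken) (use i in \<open>auto simp: R_def row_add_def\<close>)
  qed (use \<rho> in auto)
  moreover have "R 1 = M" by (auto simp: R_def fun_eq_iff)
  ultimately have "transforms n \<rho> subtract_prog (9 + (n + 1) * ((n + 1) * 80)) M S (R (n + 1)) (S(2 := -1))"
    unfolding subtract_prog_def by (metis transforms_Seq)
  then show ?thesis by (rule transforms_weaken) (auto simp: R_def)
qed

text \<open>
  Clears entry \<open>(i, k)\<close> with the pivot \<open>(k + 1, k)\<close>. If the pivot is zero, row \<open>i\<close> is first added to the
  pivot row; unlike a swap this leaves the determinant unchanged and needs no search for a pivot. If
  the pivot remains zero then entry \<open>(i, k)\<close> is zero already, and the quotient is \<open>0 / 0 = 0\<close>.
\<close>

definition elim_step :: "nat \<Rightarrow> nat \<Rightarrow> (nat \<Rightarrow> nat \<Rightarrow> real) \<Rightarrow> nat \<Rightarrow> nat \<Rightarrow> real" where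
  "elim_step k i M = (let M' = row_add M (k + 1) i (if M (k + 1) k = 0 then 1 else 0)
     in row_add M' i (k + 1) ((0 - M' i k) / M' (k + 1) k))"

text \<open>
  The state before round \<open>i\<close> of a loop that runs from \<open>k + 2\<close>; up to that point it is \<open>M\<close>.
\<close>

fun elim_column :: "nat \<Rightarrow> (nat \<Rightarrow> nat \<Rightarrow> real) \<Rightarrow> nat \<Rightarrow> nat \<Rightarrow> nat \<Rightarrow> real" where
  "elim_column k M 0 = M"
| "elim_column k M (Suc i) = (if k + 2 \<le> i then elim_step k i (elim_column k M i) else M)"

fun eliminate :: "nat \<Rightarrow> (nat \<Rightarrow> nat \<Rightarrow> real) \<Rightarrow> nat \<Rightarrow> nat \<Rightarrow> nat \<Rightarrow> real" where
  "eliminate n M 0 = M"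
| "eliminate n M (Suc k) = elim_column k (eliminate n M k) (n + 1)"

lemma elim_column_start: "i \<le> k + 2 \<Longrightarrow> elim_column k M i = M"
  by (cases i) auto

abbreviation pivot :: rexp where
  "pivot \<equiv> RMem (cell (IAdd (IReg 1) (INat 1)) (IReg 1))"

definition elim_step_prog :: prog where
  "elim_step_prog = Seq
     (Cond (BRLess (RConst 0) (RMul pivot pivot))
       (SetMem (scal 3) (RConst 0)) (SetMem (scal 3) (RConst 1)))
     (Seq (row_add_prog (IAdd (IReg 1) (INat 1)) (IReg 2) 3)
     (Seq (SetMem (scal 3) (RDiv (RSub (RConst 0) (RMem (cell (IReg 2) (IReg 1)))) pivot))
     (Seq (row_add_prog (IReg 2) (IAdd (IReg 1) (INat 1)) 3)
     (SetMem (scal 3) (RConst 0)))))"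

lemma transforms_elim_step_prog:
  assumes \<rho>: "\<rho> 0 = n" "\<rho> 1 = k" "\<rho> 2 = i" "\<rho> 3 = 0" and ki: "k < n" "k + 2 \<le> i" "i \<le> n" and S: "S 3 = 0"
  shows "transforms n \<rho> elim_step_prog ((n + 1) * 120 + 63) M S (elim_step k i M) S"
proof -
  define x where "x = (if M (k + 1) k = 0 then 1 else 0 :: real)"
  define M' where "M' = row_add M (k + 1) i x"
  define y where "y = (0 - M' i k) / M' (k + 1) k"
  let ?b = "BRLess (RConst 0) (RMul pivot pivot)"
  have "transforms n \<rho> (Cond ?b (SetMem (scal 3) (RConst 0)) (SetMem (scal 3) (RConst 1)))
      (1 + bcost ?b + 9) M S M (S(3 := x))"
  proof (rule transforms_Cond)
    show "bval ?b s \<longleftrightarrow> M (k + 1) k \<noteq> 0" if "represents n \<rho> M S s" for s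
      using \<rho> ki that by (simp add: zero_less_mult_iff linorder_neq_iff disj_commute)
    show "transforms n \<rho> (SetMem (scal 3) (RConst 0)) 9 M S M (S(3 := x))" if "M (k + 1) k \<noteq> 0"
      by (rule transforms_weaken[OF transforms_set_scal[where v = x]]) (use that in \<open>auto simp: x_def\<close>)
    show "transforms n \<rho> (SetMem (scal 3) (RConst 1)) 9 M S M (S(3 := x))" if "\<not> M (k + 1) k \<noteq> 0"
      by (rule transforms_weaken[OF transforms_set_scal[where v = x]]) (use that in \<open>auto simp: x_def\<close>)
  qed
  then have 1: "transforms n \<rho> (Cond ?b (SetMem (scal 3) (RConst 0)) (SetMem (scal 3) (RConst 1))) 29 M S M (S(3 := x))"
    by (rule transforms_weaken) auto
  have 2: "transforms n \<rho> (row_add_prog (IAdd (IReg 1) (INat 1)) (IReg 2) 3) ((n + 1) * 60) M (S(3 := x)) M' (S(3 := x))"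
    using transforms_row_add_prog[of \<rho> n "IAdd (IReg 1) (INat 1)" "k + 1" "IReg 2" i 3 M "S(3 := x)"] \<rho> ki
    by (simp add: M'_def)
  have 3: "transforms n \<rho> (SetMem (scal 3) (RDiv (RSub (RConst 0) (RMem (cell (IReg 2) (IReg 1)))) pivot))
      25 M' (S(3 := x)) M' (S(3 := y))"
    by (rule transforms_weaken[OF transforms_set_scal[where v = y]]) (use \<rho> ki in \<open>auto simp: y_def\<close>)
  have 4: "transforms n \<rho> (row_add_prog (IReg 2) (IAdd (IReg 1) (INat 1)) 3) ((n + 1) * 60) M' (S(3 := y)) (elim_step k i M) (S(3 := y))"
    using transforms_row_add_prog[of \<rho> n "IReg 2" i "IAdd (IReg 1) (INat 1)" "k + 1" 3 M' "S(3 := y)"] \<rho> ki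
    by (simp add: elim_step_def Let_def M'_def x_def y_def)
  have 5: "transforms n \<rho> (SetMem (scal 3) (RConst 0)) 9 (elim_step k i M) (S(3 := y)) (elim_step k i M) S"
    by (rule transforms_weaken[OF transforms_set_scal[where v = 0]]) (use S in auto)
  show ?thesis
    unfolding elim_step_prog_def
    by (rule transforms_weaken[OF transforms_Seq[OF 1 transforms_Seq[OF 2 transforms_Seq[OF 3 transforms_Seq[OF 4 5]]]]]) auto
qed

definition eliminate_prog :: prog where
  "eliminate_prog = for_loop 1 (INat 0) (IReg 0)
     (for_loop 2 (IAdd (IReg 1) (INat 2)) (IAdd (IReg 0) (INat 1)) elim_step_prog)"

lemma transforms_eliminate_prog:
  assumes \<rho>: "\<rho> 0 = n" "\<rho> 1 = 0" "\<rho> 2 = 0" "\<rho> 3 = 0" and S: "S 3 = 0"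
  shows "transforms n \<rho> eliminate_prog ((n + 1) * ((n + 1) * ((n + 1) * 221))) M S (eliminate n M n) S"
proof -
  have inner: "transforms n (\<rho>(1 := k)) (for_loop 2 (IAdd (IReg 1) (INat 2)) (IAdd (IReg 0) (INat 1)) elim_step_prog)
      ((n + 1) * ((n + 1) * 205)) (elim_column k M (k + 2)) S (elim_column k M (n + 1)) S" if k: "k < n" for k M
  proof (rule transforms_for_loop[where S = "\<lambda>_. S"])
    fix i assume i: "k + 2 \<le> i" "i < n + 1"
    then show "transforms n (\<rho>(1 := k, 2 := i)) elim_step_prog ((n + 1) * 120 + 63) (elim_column k M i) S (elim_column k M (Suc i)) S"
      using transforms_elim_step_prog[of "\<rho>(1 := k, 2 := i)" n k i S "elim_column k M i"] \<rho> S k by simp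
  qed (use \<rho> k in auto)
  have "transforms n \<rho> eliminate_prog ((n + 1) * ((n + 1) * ((n + 1) * 221))) (eliminate n M 0) S (eliminate n M n) S"
    unfolding eliminate_prog_def
  proof (rule transforms_for_loop[where S = "\<lambda>_. S" and M = "eliminate n M"])
    fix k assume "k < n"
    from inner[OF this, of "eliminate n M k"]
    show "transforms n (\<rho>(1 := k)) (for_loop 2 (IAdd (IReg 1) (INat 2)) (IAdd (IReg 0) (INat 1)) elim_step_prog)
      ((n + 1) * ((n + 1) * 205)) (eliminate n M k) S (eliminate n M (Suc k)) S"
      by (simp add: elim_column_start)
  qed (use \<rho> in \<open>auto simp: algebra_simps\<close>)
  then show ?thesis by simp
qed

abbreviation accumulate_factor :: rexp where
  "accumulate_factor \<equiv> RMul (RMem (scal 6))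
     (RMul (RDiv pivot (RMul (RMem (scal 5)) (RMem (scal 0)))) (RDiv pivot (RMul (RMem (scal 5)) (RMem (scal 0)))))"

abbreviation accumulate_round :: prog where
  "accumulate_round \<equiv> Seq (SetMem (scal 4) (RMul (RMem (scal 4)) pivot))
     (Seq (SetMem (scal 5) (RAdd (RMem (scal 5)) (RConst 1)))
     (SetMem (scal 6) accumulate_factor))"

text \<open>
  Scalar \<open>4\<close> becomes the determinant. Scalar \<open>5\<close> is a counter in a real cell, because registers
  cannot be converted to reals. Scalar \<open>6\<close> starts with \<open>P\<close> and is multiplied in round \<open>k\<close> by the square
  of the diagonal entry over \<open>(k + 1) * P\<close>; the result is \<open>P * (D / (n! * P ^ n))\<^sup>2\<close>, the strength, and
  it is \<open>0\<close> if \<open>P = 0\<close>.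
\<close>

definition accumulate_prog :: prog where
  "accumulate_prog = Seq (SetMem (scal 4) (RConst 1)) (Seq (SetMem (scal 6) (RMem (scal 0)))
     (for_loop 1 (INat 0) (IReg 0)
       (accumulate_round)))"

lemma transforms_accumulate_prog:
  assumes \<rho>: "\<rho> 0 = n" "\<rho> 1 = 0" and S: "S 5 = 0"
  shows "transforms n \<rho> accumulate_prog (9 + (16 + (n + 1) * 129)) M S M
     (S(4 := (\<Prod>k<n. M (k + 1) k), 5 := real n, 6 := S 0 * (\<Prod>k<n. (M (k + 1) k / (real (k + 1) * S 0))\<^sup>2)))"
proof -
  define R where "R l = S(4 := (\<Prod>k<l. M (k + 1) k), 5 := real l,
     6 := S 0 * (\<Prod>k<l. (M (k + 1) k / (real (k + 1) * S 0))\<^sup>2))" for l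
  have 1: "transforms n \<rho> (SetMem (scal 4) (RConst 1)) 9 M S M (S(4 := 1))"
    by (rule transforms_weaken[OF transforms_set_scal[where v = 1]]) auto
  have 2: "transforms n \<rho> (SetMem (scal 6) (RMem (scal 0))) 16 M (S(4 := 1)) M (R 0)"
    by (rule transforms_weaken[OF transforms_set_scal[where v = "S 0"]]) (use S in \<open>auto simp: R_def\<close>)
  have 3: "transforms n \<rho> (for_loop 1 (INat 0) (IReg 0)
       (accumulate_round)) ((n + 1) * 129) M (R 0) M (R n)"
  proof (rule transforms_for_loop)
    fix k assume k: "k < n"
    let ?m = "M (k + 1) k" and ?\<rho> = "\<rho>(1 := k)"
    have a: "transforms n ?\<rho> (SetMem (scal 4) (RMul (RMem (scal 4)) pivot)) 25
        M (R k) M ((R k)(4 := R k 4 * ?m))"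
      by (rule transforms_weaken[OF transforms_set_scal[where v = "R k 4 * ?m"]]) (use \<rho> k in auto)
    have b: "transforms n ?\<rho> (SetMem (scal 5) (RAdd (RMem (scal 5)) (RConst 1))) 18
        M ((R k)(4 := R k 4 * ?m)) M ((R k)(4 := R k 4 * ?m, 5 := real (k + 1)))"
      by (rule transforms_weaken[OF transforms_set_scal[where v = "real (k + 1)"]]) (auto simp: R_def)
    have c: "transforms n ?\<rho> (SetMem (scal 6) accumulate_factor) 70
        M ((R k)(4 := R k 4 * ?m, 5 := real (k + 1))) M (R (Suc k))"
      by (rule transforms_weaken[OF transforms_set_scal[where v = "R k 6 * (?m / (real (k + 1) * S 0))\<^sup>2"]])
        (use \<rho> k in \<open>auto simp: R_def power2_eq_square fun_eq_iff\<close>)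
    from transforms_Seq[OF a transforms_Seq[OF b c]]
    show "transforms n ?\<rho> (accumulate_round) (25 + (18 + 70)) M (R k) M (R (Suc k))" .
  qed (use \<rho> in auto)
  from transforms_Seq[OF 1 transforms_Seq[OF 2 3]] show ?thesis
    unfolding accumulate_prog_def R_def .
qed

text \<open>
  Row \<open>0\<close> of the memory matrix holds the vertex \<open>p 0\<close>; the edge vectors follow it.
\<close>

definition stored_mat :: "nat \<Rightarrow> (nat \<Rightarrow> nat \<Rightarrow> real) \<Rightarrow> real mat" where
  "stored_mat n M = Matrix.mat n n (\<lambda>(a,b). M (Suc a) b)"

lemma stored_mat_carrier [simp]: "stored_mat n M \<in> carrier_mat n n"
  by (simp add: stored_mat_def)

lemma det_row_add:
  assumes "1 \<le> a" "a \<le> n" "1 \<le> b" "b \<le> n" "a \<noteq> b"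
  shows "det (stored_mat n (row_add M a b x)) = det (stored_mat n M)"
proof -
  have "stored_mat n (row_add M a b x) = addrow x (a - 1) (b - 1) (stored_mat n M)"
    using assms by (intro eq_matI) (auto simp: row_add_def stored_mat_def)
  also have "det \<dots> = det (stored_mat n M)"
    using assms by (intro det_addrow[of _ n]) auto
  finally show ?thesis .
qed

text \<open>
  Column \<open>k\<close> is zero below its pivot, which is in row \<open>k + 1\<close> of the memory.
\<close>

definition cleared :: "nat \<Rightarrow> (nat \<Rightarrow> nat \<Rightarrow> real) \<Rightarrow> nat \<Rightarrow> bool" where
  "cleared n M k \<longleftrightarrow> (\<forall>i. k + 1 < i \<longrightarrow> i \<le> n \<longrightarrow> M i k = 0)"

lemma elim_step_clears_entry: "elim_step k i M i k = 0" if "i \<noteq> k + 1"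
  using that by (auto simp: elim_step_def Let_def row_add_def)

lemma elim_step_other_rows: "a \<noteq> k + 1 \<Longrightarrow> a \<noteq> i \<Longrightarrow> elim_step k i M a = M a"
  by (auto simp: elim_step_def Let_def row_add_def)

lemma elim_step_keeps_cleared:
  assumes "cleared n M l" "l < k" "k + 2 \<le> i" "i \<le> n"
  shows "cleared n (elim_step k i M) l"
  using assms by (auto simp: cleared_def elim_step_def Let_def row_add_def)

text \<open>
  The step for entry \<open>(i, k)\<close> changes only the rows \<open>k + 1\<close> and \<open>i\<close>, both of which are already zero in
  the cleared columns.
\<close>

lemma elim_column_spec:
  fixes M :: "nat \<Rightarrow> nat \<Rightarrow> real"
  assumes k: "k < n" and prev: "\<And>l. l < k \<Longrightarrow> cleared n M l" and i: "i \<le> n + 1"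
  shows "det (stored_mat n (elim_column k M i)) = det (stored_mat n M)
    \<and> (\<forall>l<k. cleared n (elim_column k M i) l) \<and> (\<forall>a. k + 2 \<le> a \<longrightarrow> a < i \<longrightarrow> elim_column k M i a k = 0)"
  using i
proof (induction i)
  case (Suc i)
  show ?case
  proof (cases "k + 2 \<le> i")
    case True
    let ?N = "elim_column k M i"
    have "det (stored_mat n (elim_step k i ?N)) = det (stored_mat n ?N)"
      using True Suc.prems k unfolding elim_step_def Let_def by (subst det_row_add; (subst det_row_add)?) auto
    then show ?thesis
      using Suc True elim_step_keeps_cleared[of n ?N _ k i] elim_step_clears_entry[of i k ?N] elim_step_other_rows[of _ k i ?N]
      by (auto simp: less_Suc_eq)
  qed (use Suc prev in auto)
qed (use prev in auto)

lemma eliminate_spec: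
  fixes M :: "nat \<Rightarrow> nat \<Rightarrow> real"
  assumes "k \<le> n"
  shows "det (stored_mat n (eliminate n M k)) = det (stored_mat n M)
    \<and> (\<forall>l<k. cleared n (eliminate n M k) l)"
  using assms
proof (induction k)
  case (Suc k)
  then have IH: "det (stored_mat n (eliminate n M k)) = det (stored_mat n M)"
    "\<And>l. l < k \<Longrightarrow> cleared n (eliminate n M k) l" by auto
  have "k < n" using Suc by simp
  define N where "N = elim_column k (eliminate n M k) (n + 1)"
  have spec: "det (stored_mat n N) = det (stored_mat n (eliminate n M k))" "\<And>l. l < k \<Longrightarrow> cleared n N l"
    "\<And>a. k + 2 \<le> a \<Longrightarrow> a < n + 1 \<Longrightarrow> N a k = 0"
    using elim_column_spec[OF \<open>k < n\<close> IH(2) order_refl] unfolding N_def by blast+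
  have "cleared n N k" using spec(3) unfolding cleared_def by simp
  then have "\<forall>l<Suc k. cleared n N l" using spec(2) less_Suc_eq by blast
  then show ?case using spec(1) IH(1) by (simp only: eliminate.simps N_def)
qed simp

lemma det_eq_prod_eliminate:
  fixes M :: "nat \<Rightarrow> nat \<Rightarrow> real"
  shows "det (stored_mat n M) = (\<Prod>k<n. eliminate n M n (k + 1) k)"
proof -
  let ?A = "stored_mat n (eliminate n M n)"
  have "det (stored_mat n M) = det ?A"
    using eliminate_spec[of n n M] by simp
  also have "\<dots> = prod_list (diag_mat ?A)"
    using eliminate_spec[of n n M]
    by (intro det_upper_triangular[of _ n]) (auto simp: upper_triangular_def cleared_def stored_mat_def)
  also have "\<dots> = (\<Prod>k<n. eliminate n M n (k + 1) k)"
    by (simp add: diag_mat_def prod.list_conv_set_nth lessThan_atLeast0 stored_mat_def)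
  finally show ?thesis .
qed

text \<open>
  The cells \<open>0\<close> and \<open>1\<close> lie in the region of the matrix and the scalars behind it, so writing a result
  does not overwrite a value that is still to be read.
\<close>

definition output_prog :: prog where
  "output_prog = Seq (SetMem (INat 0) (RMem (scal 6)))
     (Cond (BRLess (RMem (scal 4)) (RConst 0)) (SetMem (INat 1) (RSub (RConst 0) (RMem (scal 6)))) (SetMem (INat 1) (RMem (scal 6))))"

lemma output_prog_correct:
  assumes n: "n \<ge> 1" and s: "represents n \<rho> M S s"
  shows "\<exists>t s'. runs output_prog s t s' \<and> t \<le> 40 \<and> snd s' 0 = S 6 \<and> snd s' 1 = (if S 4 < 0 then - S 6 else S 6)"
proof -
  let ?s = "(fst s, (snd s)(0 := S 6))"
  have r1: "runs (SetMem (INat 0) (RMem (scal 6))) s 10 ?s"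
    using run_SetMem[of "INat 0" "RMem (scal 6)" s] rval_scal[OF s] by (simp add: rval.simps(2)[of "scal _"] eval_nat_numeral)
  have scal: "rval (RMem (scal c)) ?s = S c" if "c > 0" for c
  proof -
    have "(n + 1) * n + c \<noteq> 0" using that by simp
    then show ?thesis using representsD[OF s] by (simp only: rval.simps scal_def ival.simps fst_conv snd_conv fun_upd_other not_False_eq_True)
  qed
  let ?b = "BRLess (RMem (scal 4)) (RConst 0)"
  have "\<exists>t s'. runs (Cond ?b (SetMem (INat 1) (RSub (RConst 0) (RMem (scal 6)))) (SetMem (INat 1) (RMem (scal 6)))) ?s t s'
      \<and> t \<le> 30 \<and> snd s' 0 = S 6 \<and> snd s' 1 = (if S 4 < 0 then - S 6 else S 6)"
  proof (cases "S 4 < 0")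
    case True
    then have b: "bval ?b ?s" using scal[of 4] by simp
    show ?thesis
      by (intro exI conjI, rule run_CondTrue[OF b run_SetMem]) (use True scal[of 6] in auto)
  next
    case False
    then have b: "\<not> bval ?b ?s" using scal[of 4] by simp
    show ?thesis
      by (intro exI conjI, rule run_CondFalse[OF b run_SetMem]) (use False scal[of 6] in auto)
  qed
  then obtain t s' where "runs (Cond ?b (SetMem (INat 1) (RSub (RConst 0) (RMem (scal 6)))) (SetMem (INat 1) (RMem (scal 6)))) ?s t s'"
      "t \<le> 30" "snd s' 0 = S 6" "snd s' 1 = (if S 4 < 0 then - S 6 else S 6)" by blast
  then show ?thesis unfolding output_prog_def using run_Seq[OF r1] by fastforce
qed

definition strength_prog :: prog where
  "strength_prog = Seq perimeter_prog (Seq subtract_prog (Seq eliminate_prog (Seq accumulate_prog output_prog)))"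

definition strength_time :: "nat \<Rightarrow> nat" where
  "strength_time n = 1000 * (n + 1) ^ 3"

text \<open>
  The four stages give the half-perimeter \<open>P\<close>, the edge matrix (transposed), an upper triangular matrix
  with the same determinant, and the quotient \<open>P * (D / (n! * P ^ n))\<^sup>2\<close>, which is the strength.
\<close>

lemma strength_prog_correct: "computes_strengths_within strength_prog strength_time"
  unfolding computes_strengths_within_def
proof (intro allI impI)
  fix n :: nat and p assume n: "n \<ge> 1" and p: "simplex_points n p"
  let ?\<rho> = "(\<lambda>_. 0 :: nat)(0 := n)"
  define X where "X = (\<lambda>i k. vec_index (p i) k)"
  have c: "p i \<in> carrier_vec n" if "i \<le> n" for i using p that by (simp add: simplex_points_def)
  have init: "represents n ?\<rho> X (\<lambda>_. 0) (input_state n p)"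
  proof (rule representsI)
    show "snd (input_state n p) (i * n + k) = X i k" if "i \<le> n" "k < n" for i k
      using cell_address_less[OF that] that by (simp add: input_state_def X_def)
  qed (auto simp: input_state_def)
  let ?d = "\<lambda>i j. sqrt (\<Sum>k<n. (X i k - X j k)\<^sup>2)"
  define P where "P = (\<Sum>j\<le>n. \<Sum>i<j. ?d i j) / 2"
  have P: "P = half_perimeter n p"
    unfolding P_def half_perimeter_def using c by (simp add: vnorm_diff[of _ n] X_def L2_set_def)
  define Y where "Y = (\<lambda>a k. if 1 \<le> a then X a k - X 0 k else X a k)"
  define E where "E = eliminate n Y n"
  let ?D = "\<Prod>k<n. E (k + 1) k"
  have D: "?D = simplex_det n p"
  proof -
    have "?D = det (stored_mat n Y)"
      by (simp only: det_eq_prod_eliminate E_def)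
    also have "stored_mat n Y = transpose_mat (edge_mat n p)"
      by (rule eq_matI) (auto simp: stored_mat_def Y_def X_def edge_mat_index[OF p])
    also have "det \<dots> = simplex_det n p" by (rule det_transpose[of _ n]) simp
    finally show ?thesis .
  qed
  define S where "S = (\<lambda>_::nat. 0)(0 := P, 2 := -1 :: real)"
  define F where "F = S(4 := ?D, 5 := real n, 6 := S 0 * (\<Prod>k<n. (E (k + 1) k / (real (k + 1) * S 0))\<^sup>2))"
  have "transforms n ?\<rho> perimeter_prog ((n + 1) * ((n + 1) * ((n + 1) * 140)) + 18) X (\<lambda>_. 0) X ((\<lambda>_. 0)(0 := P))"
    unfolding P_def by (rule transforms_perimeter_prog) auto
  moreover have "transforms n ?\<rho> subtract_prog (9 + (n + 1) * ((n + 1) * 80)) X ((\<lambda>_. 0)(0 := P)) Y S"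
    unfolding Y_def S_def by (rule transforms_subtract_prog) auto
  moreover have "transforms n ?\<rho> eliminate_prog ((n + 1) * ((n + 1) * ((n + 1) * 221))) Y S E S"
    unfolding E_def by (rule transforms_eliminate_prog) (auto simp: S_def)
  moreover have "transforms n ?\<rho> accumulate_prog (9 + (16 + (n + 1) * 129)) E S E F"
    unfolding F_def by (rule transforms_accumulate_prog) (auto simp: S_def)
  ultimately obtain t1 s1 t2 s2 t3 s3 t4 s4 where
    t1: "runs perimeter_prog (input_state n p) t1 s1" "t1 \<le> (n + 1) * ((n + 1) * ((n + 1) * 140)) + 18"
    and t2: "runs subtract_prog s1 t2 s2" "t2 \<le> 9 + (n + 1) * ((n + 1) * 80)"
    and t3: "runs eliminate_prog s2 t3 s3" "t3 \<le> (n + 1) * ((n + 1) * ((n + 1) * 221))"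
    and t4: "runs accumulate_prog s3 t4 s4" "t4 \<le> 9 + (16 + (n + 1) * 129)" "represents n ?\<rho> E F s4"
    using init unfolding transforms_def by meson
  obtain t5 s5 where t5: "runs output_prog s4 t5 s5" "t5 \<le> 40" "snd s5 0 = F 6"
    "snd s5 1 = (if F 4 < 0 then - F 6 else F 6)"
    using output_prog_correct[OF n t4(3)] by blast
  have "runs strength_prog (input_state n p) (t1 + (t2 + (t3 + (t4 + t5)))) s5"
    unfolding strength_prog_def 
    by (rule run_Seq[OF t1(1) run_Seq[OF t2(1) run_Seq[OF t3(1) run_Seq[OF t4(1) t5(1)]]]])
  moreover have "t1 + (t2 + (t3 + (t4 + t5))) \<le> strength_time n"
  proof -
    have "t1 + (t2 + (t3 + (t4 + t5))) \<le> 92 + 129 * (n + 1) + 80 * ((n + 1) * (n + 1)) + 361 * ((n + 1) * ((n + 1) * (n + 1)))"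
      using t1(2) t2(2) t3(2) t4(2) t5(2) by (simp add: algebra_simps)
    also have "\<dots> \<le> 1000 * ((n + 1) * ((n + 1) * (n + 1)))"
      by (simp add: algebra_simps)
    finally show ?thesis unfolding strength_time_def power3_eq_cube mult.assoc .
  qed
  moreover have F6: "F 6 = strength n p"
  proof -
    have "(\<Prod>k<n. (E (k + 1) k / (real (k + 1) * P))\<^sup>2) = (\<Prod>k<n. E (k + 1) k / (real (k + 1) * P))\<^sup>2"
      by (rule prod_power_distrib[symmetric])
    also have "(\<Prod>k<n. E (k + 1) k / (real (k + 1) * P)) = ?D / ((\<Prod>k<n. real (k + 1)) * P ^ n)"
      by (simp add: prod_dividef prod.distrib)
    also have "(\<Prod>k<n. real (k + 1)) = fact n"
      by (simp add: fact_prod_Suc lessThan_atLeast0)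
    finally have "F 6 = P * (simplex_det n p / (fact n * P ^ n))\<^sup>2"
      unfolding F_def S_def D by simp
    also have "\<dots> = strength n p"
    proof (cases "P = 0")
      case True
      then show ?thesis by (simp add: strength_def P)
    next
      case False
      define m where "m = 2 * n - 1"
      have "n + n = Suc m" using n by (simp add: m_def)
      then have "P ^ n * P ^ n = P * P ^ m" by (simp only: power_add[symmetric] power_Suc)
      then have "(fact n * P ^ n)\<^sup>2 = (fact n)\<^sup>2 * (P * P ^ m)"
        by (simp only: power_mult_distrib power2_eq_square[of "P ^ n"])
      then show ?thesis using False
        unfolding strength_eq[OF n p] P[symmetric] m_def[symmetric] power_divide by simp
    qed
    finally show ?thesis .
  qed
  moreover have "(if F 4 < 0 then - F 6 else F 6) = signed_strength n p"
  proof -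
    have "F 4 = simplex_det n p" unfolding F_def D by simp
    moreover have "strength n p = 0" if "simplex_det n p = 0"
      using that by (simp add: strength_eq[OF n p])
    ultimately show ?thesis
      by (auto simp: F6 signed_strength_def simplex_sign_eq sgn_real_def)
  qed
  ultimately show "\<exists>t s. runs strength_prog (input_state n p) t s \<and> t \<le> strength_time n \<and>
      snd s 0 = strength n p \<and> snd s 1 = signed_strength n p"
    using t5(3,4) by metis
qed

lemma strength_time_cubic: "(\<lambda>n. real (strength_time n)) \<in> O(\<lambda>n. real n ^ 3)"
proof (rule bigoI[where c = 8000])
  show "\<forall>\<^sub>F n in sequentially. norm (real (strength_time n)) \<le> 8000 * norm (real n ^ 3)"
    using eventually_ge_at_top[of 1]
  proof eventually_elim
    case (elim n)
    have "real (n + 1) ^ 3 \<le> (2 * real n) ^ 3" using elim by (intro power_mono) auto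
    then show ?case by (simp add: strength_time_def power_mult_distrib)
  qed
qed

section \<open>Invariance, computability and continuity of the strength\<close>

theorem theorem2p4:
  shows "((\<forall>n\<ge>1. \<forall>p. simplex_points n p \<longrightarrow>
            (\<forall>f. is_isometry n f \<longrightarrow> strength n (\<lambda>i. f (p i)) = strength n p) \<and>
            (\<forall>f. rigid_motion n f \<longrightarrow> signed_strength n (\<lambda>i. f (p i)) = signed_strength n p) \<and>
            (\<forall>c>0. strength n (\<lambda>i. c \<cdot>\<^sub>v p i) = c * strength n p \<and>
                    signed_strength n (\<lambda>i. c \<cdot>\<^sub>v p i) = c * signed_strength n p)) \<and>
          (\<exists>c time. (\<lambda>n. real (time n)) \<in> O(\<lambda>n. real n ^ 3) \<and>
                    computes_strengths_within c time)) \<and>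
         (\<exists>lam :: nat \<Rightarrow> real.
            (\<forall>n\<ge>1. lam n > 0 \<and>
               (\<forall>\<epsilon>>0. \<forall>p q. simplex_points n p \<longrightarrow> simplex_points n q \<longrightarrow>
                  (\<forall>i\<le>n. vnorm (p i - q i) \<le> \<epsilon>) \<longrightarrow>
                  \<bar>strength n p - strength n q\<bar> \<le> 2 * lam n * \<epsilon> \<and>
                  \<bar>signed_strength n p - signed_strength n q\<bar> \<le> 2 * lam n * \<epsilon>)) \<and>
            lam 1 = 2 \<and> lam 2 = sqrt 3 \<and>
            (\<forall>n\<ge>3. lam n \<le> 2 powr (real n + 1/2) / (fact n * real n ^ (2 * n - 4))) \<and>
            lam 3 < 37/100)"
proof (intro conjI)
  show "\<forall>n\<ge>1. \<forall>p. simplex_points n p \<longrightarrow>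
      (\<forall>f. is_isometry n f \<longrightarrow> strength n (\<lambda>i. f (p i)) = strength n p) \<and>
      (\<forall>f. rigid_motion n f \<longrightarrow> signed_strength n (\<lambda>i. f (p i)) = signed_strength n p) \<and>
      (\<forall>c>0. strength n (\<lambda>i. c \<cdot>\<^sub>v p i) = c * strength n p \<and>
              signed_strength n (\<lambda>i. c \<cdot>\<^sub>v p i) = c * signed_strength n p)"
    using strength_isometry_invariant signed_strength_rigid_invariant strengths_scale by blast
  show "\<exists>c time. (\<lambda>n. real (time n)) \<in> O(\<lambda>n. real n ^ 3) \<and> computes_strengths_within c time"
    using strength_time_cubic strength_prog_correct by blast
  show "\<exists>lam :: nat \<Rightarrow> real.
      (\<forall>n\<ge>1. lam n > 0 \<and>
         (\<forall>\<epsilon>>0. \<forall>p q. simplex_points n p \<longrightarrow> simplex_points n q \<longrightarrow>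
            (\<forall>i\<le>n. vnorm (p i - q i) \<le> \<epsilon>) \<longrightarrow>
            \<bar>strength n p - strength n q\<bar> \<le> 2 * lam n * \<epsilon> \<and>
            \<bar>signed_strength n p - signed_strength n q\<bar> \<le> 2 * lam n * \<epsilon>)) \<and>
      lam 1 = 2 \<and> lam 2 = sqrt 3 \<and>
      (\<forall>n\<ge>3. lam n \<le> 2 powr (real n + 1/2) / (fact n * real n ^ (2 * n - 4))) \<and>
      lam 3 < 37/100"
  proof (intro exI[of _ lipschitz_constant] conjI allI impI)
    show "lipschitz_constant 1 = 2" "lipschitz_constant 2 = sqrt 3"
      by (simp_all add: lipschitz_constant_def)
  qed (simp_all only: lipschitz_constant_pos lipschitz_constant_bound lipschitz_constant_3
      strengths_lipschitz_constant)
qed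


end
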